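(* Let $q$ be an odd prime power. Fix some even nonnegative integer $2n$ and some $T\in\operatorname{Alt}_{2n}^\times$. Further, fix $d\in(\mathbb F_q^\times)^2$ and $t\in\mathbb F_q$. Then the number $N(d,t)$ of $A\in\operatorname{Alt}_{2n}^\times$ such that $\det A=d$ and $\operatorname{tr}AT=t$ is $$\frac2{q(q-1)}\left(q^{n(n-1)}\prod_{i=1}^{n}\left(q^{2i-1}-1\right)-q^{n(n-1)}(q-1)^n\right)$$ $$+\,q^{n(n-1)}\,\#\left\{(y_1,\ldots,y_n)\in\mathbb F_q^n:2(y_1+\cdots+y_n)=t,\ \frac{(y_1\cdots y_n)^2}{\det T}=d\right\}.$$
   Context: $\operatorname{Alt}_{2n}^\times$ is the set of invertible alternating ($A^\intercal=-A$) $2n\times2n$ matrices over $\mathbb F_q$; $(\mathbb F_q^\times)^2$ is the set of nonzero squares. *)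

theory Defs
  imports "Jordan_Normal_Form.Determinant" "HOL-Number_Theory.Prime_Powers"
begin

definition trace_mat :: "'a::comm_monoid_add mat \<Rightarrow> 'a" where
  "trace_mat A = (\<Sum>i<dim_row A. A $$ (i, i))"

(* Alternating is read as skew-symmetric, so this is the intended set only over rings in which
   2 is not a zero divisor.  The size m may be 0; the empty matrix is then the only element. *)
definition Alt_units :: "nat \<Rightarrow> 'a::comm_ring_1 mat set" where
  "Alt_units m = {A \<in> carrier_mat m m. transpose_mat A = - A \<and> invertible_mat A}"

definition nonzero_squares :: "'a::comm_ring_1 set" where
  "nonzero_squares = {x ^ 2 | x. x \<noteq> 0}"

end

theory Submission
  imports Defs "Berlekamp_Zassenhaus.Berlekamp_Type_Based"
begin

text \<open>
  As \<^term>\<open>d \<noteq> 0\<close>, the condition on the determinant already makes a matrix invertible, so the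
  count runs over all skew-symmetric \<open>A\<close> of size \<open>2n\<close>.  Write \<open>N(T, d, t)\<close> for it, and \<open>Y(n, e, t)\<close>
  for the number of \<open>y\<close> in \<open>F\<^sup>n\<close> with \<open>2 (y\<^sub>1 + \<dots> + y\<^sub>n) = t\<close> and \<open>(y\<^sub>1 \<cdots> y\<^sub>n)\<^sup>2 = e\<close>.  The core of the proof is
  that \<open>N(T, d, t) - q\<^bsup>n(n-1)\<^esup> Y(n, d det T, t)\<close> does not depend on \<open>t\<close>
  (\<open>trace_count_eq_const_plus_torus_count\<close>), by induction on \<open>n\<close>.

  Let \<open>e\<^sub>0, e\<^sub>1, \<dots>\<close> be the unit vectors.  A congruence \<open>T \<mapsto> P T P\<^sup>T\<close> multiplies \<open>det T\<close> and divides \<open>d\<close>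
  by \<open>(det P)\<^sup>2\<close>, so row 1 of \<open>T\<close> may be taken to be \<open>c e\<^sub>0\<close>.  Now sort the matrices \<open>A\<close> by their
  row 0, say \<open>r\<close>.  Adding \<open>s\<close> times row and column 0 of \<open>A\<close> to row and column \<open>j \<noteq> 0\<close> keeps \<open>r\<close> and the
  determinant and adds \<open>2 s (r T)\<^sub>j\<close> to the trace of \<open>A T\<close>.  Hence every trace is equally frequent
  above \<open>r\<close>, unless \<open>r T\<close> is a multiple of \<open>e\<^sub>0\<close>; as \<open>T\<close> is invertible and \<open>e\<^sub>1 T = c e\<^sub>0\<close>, this happens
  only for \<open>r = b e\<^sub>1\<close>.  Above such an \<open>r\<close> with \<open>b \<noteq> 0\<close> the rest of row 1 is free, which gives a factor
  \<open>q\<^bsup>2n-2\<^esup>\<close>, and the lower right blocks \<open>A'\<close>, \<open>T'\<close> of size \<open>2n - 2\<close> satisfy \<open>det A = b\<^sup>2 det A'\<close>,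
  \<open>det T = c\<^sup>2 det T'\<close> and \<open>tr (A T) = 2 b c + tr (A' T')\<close>.  With \<open>y = b c\<close> this is the recursion that
  \<open>Y\<close> satisfies when one coordinate \<open>y\<close> is split off.

  The missing constant follows by summing over all \<open>t\<close>, once the number of \<open>A\<close> with determinant \<open>d\<close>
  (\<open>card_skew_mats_det\<close>) and the number of \<open>y\<close> with \<open>(y\<^sub>1 \<cdots> y\<^sub>n)\<^sup>2 = d det T\<close> (\<open>card_vec_prod_square\<close>)
  are known.  The latter needs \<open>d det T\<close> to be a square, that is, that skew-symmetric determinants
  are squares (\<open>det_skew_mats_square\<close>).
\<close>

section \<open>Finite counting\<close>

text \<open>
  Translation by 1 permutes the field, so comparing the sums of all elements gives \<open>q = 0\<close> in the
  field.  If also \<open>2 = 0\<close>, an odd \<open>q\<close> would give \<open>1 = 0\<close>.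
\<close>
lemma two_nonzero_if_odd_card:
  assumes "odd (card (UNIV :: 'a::{field,finite} set))"
  shows "(2::'a) \<noteq> 0"
proof
  assume two: "(2::'a) = 0"
  have "(\<Sum>x\<in>UNIV. x + 1) = (\<Sum>x\<in>(UNIV::'a set). x)"
    by (rule sum.reindex_bij_witness[of _ "\<lambda>x. x - 1" "\<lambda>x. x + 1"]) auto
  then have "of_nat (card (UNIV :: 'a set)) = (0::'a)"
    by (simp add: sum.distrib)
  moreover obtain k where "card (UNIV :: 'a set) = 2 * k + 1"
    using assms oddE by blast
  ultimately show False using two by simp
qed

lemma card_eq_sum_card_fibres:
  assumes "finite S" "finite R" "\<And>x. x \<in> S \<Longrightarrow> f x \<in> R"
  shows "card S = (\<Sum>r\<in>R. card {x \<in> S. f x = r})"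
  using sum.group[of S R f "\<lambda>_. 1::nat"] assms by (simp add: image_subset_iff)

lemma finite_carrier_mat: "finite (carrier_mat n m :: 'a::finite mat set)"
proof (rule finite_surj)
  show "finite (({..<n} \<times> {..<m}) \<rightarrow>\<^sub>E (UNIV :: 'a set))" by (intro finite_PiE) auto
  show "carrier_mat n m \<subseteq> mat n m ` (({..<n} \<times> {..<m}) \<rightarrow>\<^sub>E (UNIV :: 'a set))"
  proof
    fix A :: "'a mat" assume "A \<in> carrier_mat n m"
    then show "A \<in> mat n m ` (({..<n} \<times> {..<m}) \<rightarrow>\<^sub>E UNIV)"
      by (intro image_eqI[where x = "restrict (\<lambda>ij. A $$ ij) ({..<n} \<times> {..<m})"]) auto
  qed
qed

lemma vec_eq_vCons_tail:
  assumes "w \<in> carrier_vec (Suc n)"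
  shows "w = vCons (w $ 0) (vec n (\<lambda>i. w $ Suc i))"
proof (rule eq_vecI)
  fix i assume "i < dim_vec (vCons (w $ 0) (vec n (\<lambda>i. w $ Suc i)))"
  then show "w $ i = vCons (w $ 0) (vec n (\<lambda>i. w $ Suc i)) $ i"
    by (cases i) simp_all
qed (use assms in simp)

lemma carrier_vec_Suc_head:
  "{w \<in> carrier_vec (Suc n). w $ 0 = a \<and> P w} = vCons a ` {v \<in> carrier_vec n. P (vCons a v)}"
proof (intro equalityI subsetI)
  fix w assume w: "w \<in> {w \<in> carrier_vec (Suc n). w $ 0 = a \<and> P w}"
  then have eq: "w = vCons a (vec n (\<lambda>i. w $ Suc i))"
    using vec_eq_vCons_tail[of w n] by simp
  show "w \<in> vCons a ` {v \<in> carrier_vec n. P (vCons a v)}"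
  proof (rule image_eqI)
    show "w = vCons a (vec n (\<lambda>i. w $ Suc i))" by (rule eq)
    show "vec n (\<lambda>i. w $ Suc i) \<in> {v \<in> carrier_vec n. P (vCons a v)}"
      using w unfolding mem_Collect_eq eq[symmetric] by simp
  qed
next
  fix w assume "w \<in> vCons a ` {v \<in> carrier_vec n. P (vCons a v)}"
  then show "w \<in> {w \<in> carrier_vec (Suc n). w $ 0 = a \<and> P w}"
    by (elim imageE) simp
qed

lemma card_carrier_vec_Suc_head:
  "card {w \<in> carrier_vec (Suc n). w $ 0 = a \<and> P w} = card {v \<in> carrier_vec n. P (vCons a v)}"
  unfolding carrier_vec_Suc_head by (rule card_image) (simp add: inj_on_def)

lemma card_vec_head_zero:
  "card {r \<in> carrier_vec (Suc n) :: 'a::{field,finite} vec set. r $ 0 = 0 \<and> r \<noteq> 0\<^sub>v (Suc n)}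
     = card (UNIV :: 'a set) ^ n - 1"
proof -
  have "{v \<in> carrier_vec n. vCons 0 v \<noteq> 0\<^sub>v (Suc n)} = carrier_vec n - {0\<^sub>v n :: 'a vec}"
    by (simp add: zero_vec_Suc set_diff_eq)
  then show ?thesis
    unfolding card_carrier_vec_Suc_head
    by (simp add: card_carrier_vec card_Diff_singleton)
qed

section \<open>Skew-symmetric matrices and congruence\<close>

text \<open>
  Invertibility is left out because the counts that matter fix a nonzero determinant.
\<close>
definition skew_mats :: "nat \<Rightarrow> 'a::comm_ring_1 mat set" where
  "skew_mats m = {A \<in> carrier_mat m m. transpose_mat A = - A}"

lemma skew_mats_iff:
  "A \<in> skew_mats m \<longleftrightarrow> A \<in> carrier_mat m m \<and> (\<forall>i<m. \<forall>j<m. A $$ (j, i) = - A $$ (i, j))"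
proof -
  have "transpose_mat A = - A \<longleftrightarrow> (\<forall>i<m. \<forall>j<m. A $$ (j, i) = - A $$ (i, j))"
    if "A \<in> carrier_mat m m"
  proof
    assume eq: "transpose_mat A = - A"
    show "\<forall>i<m. \<forall>j<m. A $$ (j, i) = - A $$ (i, j)"
    proof (intro allI impI)
      fix i j assume "i < m" "j < m"
      then show "A $$ (j, i) = - A $$ (i, j)"
        using arg_cong[OF eq, of "\<lambda>B. B $$ (i, j)"] that by simp
    qed
  next
    assume eq: "\<forall>i<m. \<forall>j<m. A $$ (j, i) = - A $$ (i, j)"
    show "transpose_mat A = - A"
    proof (rule eq_matI)
      fix i j assume "i < dim_row (- A)" "j < dim_col (- A)"
      then have ij: "i < m" "j < m" using that by auto
      show "transpose_mat A $$ (i, j) = (- A) $$ (i, j)"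
        using that ij eq[rule_format, OF ij] by simp
    qed (use that in auto)
  qed
  then show ?thesis unfolding skew_mats_def mem_Collect_eq by (rule conj_cong[OF refl])
qed

lemma skew_mats_carrier: "A \<in> skew_mats m \<Longrightarrow> A \<in> carrier_mat m m"
  by (simp add: skew_mats_def)

lemma skew_mats_entry:
  "A \<in> skew_mats m \<Longrightarrow> i < m \<Longrightarrow> j < m \<Longrightarrow> A $$ (j, i) = - A $$ (i, j)"
  unfolding skew_mats_iff by blast

lemma skew_mats_diag:
  fixes A :: "'a::field mat"
  assumes "(2::'a) \<noteq> 0" "A \<in> skew_mats m" "i < m"
  shows "A $$ (i, i) = 0"
proof -
  have "A $$ (i, i) + A $$ (i, i) = 0"
    using skew_mats_entry[OF assms(2,3,3)] eq_neg_iff_add_eq_0 by blast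
  then show ?thesis using assms(1) by (simp flip: mult_2)
qed

lemma finite_skew_mats: "finite (skew_mats m :: 'a::{comm_ring_1,finite} mat set)"
  by (rule finite_subset[OF _ finite_carrier_mat[of m m]]) (simp add: skew_mats_def Collect_mono)

lemma Alt_units_iff:
  fixes A :: "'a::field mat"
  shows "A \<in> Alt_units m \<longleftrightarrow> A \<in> skew_mats m \<and> det A \<noteq> 0"
proof -
  have "invertible_mat A \<longleftrightarrow> det A \<noteq> 0" if A: "A \<in> carrier_mat m m"
  proof
    assume "invertible_mat A"
    then obtain B where B: "A * B = 1\<^sub>m m" "B * A = 1\<^sub>m (dim_row B)"
      using A by (auto simp: invertible_mat_def inverts_mat_def)
    then have "B \<in> carrier_mat m m"
      using A by (metis carrier_matD(2) carrier_matI index_mult_mat(3) index_one_mat(3))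
    then have "det A * det B = 1" using B A by (metis det_mult det_one)
    then show "det A \<noteq> 0" by auto
  next
    assume "det A \<noteq> 0"
    then obtain B where "B \<in> carrier_mat m m" "B * A = 1\<^sub>m m" "A * B = 1\<^sub>m m"
      using det_non_zero_imp_unit[OF A, of "()"] by (auto simp: Units_def ring_mat_def)
    then show "invertible_mat A"
      using A unfolding invertible_mat_def inverts_mat_def by auto
  qed
  then show ?thesis unfolding Alt_units_def skew_mats_def mem_Collect_eq by argo
qed

lemma trace_mat_mult:
  assumes "A \<in> carrier_mat m n" "B \<in> carrier_mat n m"
  shows "trace_mat (A * B) = (\<Sum>i<m. \<Sum>j<n. A $$ (i, j) * B $$ (j, i))"
  using assms by (simp add: trace_mat_def scalar_prod_def lessThan_atLeast0)

lemma trace_mat_mult_commute: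
  fixes A :: "'a::comm_semiring_0 mat"
  assumes "A \<in> carrier_mat m n" "B \<in> carrier_mat n m"
  shows "trace_mat (A * B) = trace_mat (B * A)"
  unfolding trace_mat_mult[OF assms] trace_mat_mult[OF assms(2,1)]
  by (subst sum.swap) (simp add: mult.commute)

lemma congruence_skew_mats:
  fixes A :: "'a::comm_ring_1 mat"
  assumes "A \<in> skew_mats m" "P \<in> carrier_mat m m"
  shows "P * A * transpose_mat P \<in> skew_mats m"
proof -
  have A: "A \<in> carrier_mat m m" "transpose_mat A = - A" using assms(1) by (auto simp: skew_mats_def)
  have "transpose_mat (P * A * transpose_mat P) = P * (transpose_mat A * transpose_mat P)"
    using A assms(2) by (simp add: transpose_mult[of _ m m _ m])
  also have "\<dots> = - (P * A * transpose_mat P)"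
    using A assms(2) by (simp add: assoc_mult_mat[of _ m m _ m _ m])
  finally show ?thesis using A assms(2) by (simp add: skew_mats_def)
qed

lemma det_congruence:
  fixes A :: "'a::comm_ring_1 mat"
  assumes "A \<in> carrier_mat m m" "P \<in> carrier_mat m m"
  shows "det (P * A * transpose_mat P) = det A * det P ^ 2"
  using assms by (simp add: det_mult[of _ m] det_transpose power2_eq_square)

lemma congruence_inverse:
  fixes A :: "'a::comm_ring_1 mat"
  assumes "A \<in> carrier_mat m m" "P \<in> carrier_mat m m" "Q \<in> carrier_mat m m" "Q * P = 1\<^sub>m m"
  shows "Q * (P * A * transpose_mat P) * transpose_mat Q = A"
proof -
  have QP: "transpose_mat P * transpose_mat Q = 1\<^sub>m m"
    using assms(2-4) by (metis transpose_mult transpose_one)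
  have "Q * (P * A * transpose_mat P) * transpose_mat Q
      = (Q * P) * A * (transpose_mat P * transpose_mat Q)"
    using assms(1-3) by (simp add: assoc_mult_mat[of _ m m _ m _ m])
  then show ?thesis using assms QP by simp
qed

lemma bij_betw_congruence:
  fixes P :: "'a::field mat"
  assumes "P \<in> carrier_mat m m" "Q \<in> carrier_mat m m" "P * Q = 1\<^sub>m m"
  shows "bij_betw (\<lambda>A. P * A * transpose_mat P) (skew_mats m) (skew_mats m)"
proof (rule bij_betw_byWitness[where f' = "\<lambda>A. Q * A * transpose_mat Q"])
  have "Q * P = 1\<^sub>m m" using mat_mult_left_right_inverse assms by blast
  then show "\<forall>A\<in>skew_mats m. Q * (P * A * transpose_mat P) * transpose_mat Q = A"
    using congruence_inverse assms skew_mats_carrier by blast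
  show "\<forall>A\<in>skew_mats m. P * (Q * A * transpose_mat Q) * transpose_mat P = A"
    using congruence_inverse assms skew_mats_carrier by blast
  show "(\<lambda>A. P * A * transpose_mat P) ` skew_mats m \<subseteq> skew_mats m"
    using congruence_skew_mats[OF _ assms(1)] by (rule image_subsetI)
  show "(\<lambda>A. Q * A * transpose_mat Q) ` skew_mats m \<subseteq> skew_mats m"
    using congruence_skew_mats[OF _ assms(2)] by (rule image_subsetI)
qed

text \<open>
  The left factor leaves row \<open>i\<close> of \<open>A\<close> alone, so only the change of the columns acts on it.
\<close>
lemma row_congruence:
  fixes A :: "'a::comm_ring_1 mat"
  assumes "A \<in> carrier_mat m m" "P \<in> carrier_mat m m" "i < m" "row P i = unit_vec m i"
  shows "row (P * A * transpose_mat P) i = P *\<^sub>v row A i"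
proof -
  have "row (P * A) i = row A i"
    using assms by (intro eq_vecI) (auto simp: scalar_prod_left_unit)
  then show ?thesis using assms
    by (intro eq_vecI) (auto simp: row_mult comm_scalar_prod[of _ m])
qed

section \<open>Moving a vector to a multiple of a unit vector\<close>

text \<open>
  The matrix \<open>P = 1 + x y\<^sup>T\<close> with \<open>y \<bullet> x = 0\<close> has the inverse \<open>1 - x y\<^sup>T\<close>.  If \<open>y\<^sub>k = 1\<close> and
  \<open>c = y \<bullet> r\<close> is nonzero, then \<open>x = e\<^sub>k - r / c\<close> meets this condition and \<open>P r = r + c x = c e\<^sub>k\<close>.  Row \<open>i\<close> of
  \<open>P\<close> is a unit vector because \<open>x\<^sub>i = 0\<close>; this makes \<open>P\<close> act on row \<open>i\<close> of a matrix \<open>A\<close> under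
  \<open>A \<mapsto> P A P\<^sup>T\<close> simply as on a vector.
\<close>
lemma exists_transvection_to_unit_vec:
  fixes r :: "'a::field vec"
  assumes r: "r \<in> carrier_vec m" "r $ i = 0" "r \<noteq> 0\<^sub>v m" and ik: "i < m" "k < m" "i \<noteq> k"
  obtains P Q c where "P \<in> carrier_mat m m" "Q \<in> carrier_mat m m" "P * Q = 1\<^sub>m m"
    "row P i = unit_vec m i" "c \<noteq> 0" "P *\<^sub>v r = c \<cdot>\<^sub>v unit_vec m k"
proof -
  \<comment> \<open>If \<open>r\<^sub>k = 0\<close>, another unit vector has to be added to \<open>e\<^sub>k\<close> to make \<open>y \<bullet> r\<close> nonzero.\<close>
  obtain y where y: "y \<in> carrier_vec m" "y $ k = 1" "y \<bullet> r \<noteq> 0"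
  proof (cases "r $ k = 0")
    case False
    then show ?thesis using that[of "unit_vec m k"] r ik by (simp add: scalar_prod_left_unit)
  next
    case True
    obtain j where "j < m" "r $ j \<noteq> 0" using r(1,3) by (metis carrier_vecD eq_vecI index_zero_vec)
    moreover from this True have "k \<noteq> j" by auto
    ultimately show ?thesis using that[of "unit_vec m k + unit_vec m j"] r ik True
      by (auto simp: add_scalar_prod_distrib[of _ m] scalar_prod_left_unit)
  qed
  define c where "c = y \<bullet> r"
  define x where "x = unit_vec m k - inverse c \<cdot>\<^sub>v r"
  have x: "x \<in> carrier_vec m" using r by (simp add: x_def)
  have yx: "y \<bullet> x = 0"
    using y r ik by (simp add: x_def scalar_prod_minus_distrib[of _ m] scalar_prod_right_unit c_def)
  define X where "X = mat m m (\<lambda>(a, b). x $ a * y $ b)"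
  have X: "X \<in> carrier_mat m m" by (simp add: X_def)
  have XX: "X * X = 0\<^sub>m m m"
  proof (rule eq_matI)
    fix a b assume ab: "a < dim_row (0\<^sub>m m m :: 'a mat)" "b < dim_col (0\<^sub>m m m :: 'a mat)"
    have "(X * X) $$ (a, b) = (\<Sum>l<m. x $ a * (y $ l * x $ l) * y $ b)"
      using ab by (simp add: X_def scalar_prod_def lessThan_atLeast0 mult.assoc)
    also have "\<dots> = x $ a * (y \<bullet> x) * y $ b"
      using x by (simp add: scalar_prod_def lessThan_atLeast0 sum_distrib_left sum_distrib_right)
    finally show "(X * X) $$ (a, b) = 0\<^sub>m m m $$ (a, b)" using ab yx by simp
  qed (auto simp: X_def)
  show thesis
  proof (rule that)
    show "1\<^sub>m m + X \<in> carrier_mat m m" "1\<^sub>m m - X \<in> carrier_mat m m"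
      using X by auto
    have "(1\<^sub>m m + X) * (1\<^sub>m m - X) = (1\<^sub>m m - X) + X * (1\<^sub>m m - X)"
      using X by (subst add_mult_distrib_mat[of _ m m _ _ m]) (simp_all add: minus_carrier_mat)
    also have "X * (1\<^sub>m m - X) = X * 1\<^sub>m m - X * X"
      using X by (intro mult_minus_distrib_mat) simp_all
    also have "\<dots> = X"
      unfolding XX using X by (intro eq_matI) auto
    also have "(1\<^sub>m m - X) + X = 1\<^sub>m m"
      using X by (intro eq_matI) auto
    finally show "(1\<^sub>m m + X) * (1\<^sub>m m - X) = 1\<^sub>m m" .
    show "row (1\<^sub>m m + X) i = unit_vec m i"
      using ik r x by (intro eq_vecI) (auto simp: X_def x_def)
    show "c \<noteq> 0" using y by (simp add: c_def)
    have "X *\<^sub>v r = c \<cdot>\<^sub>v x"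
    proof (rule eq_vecI)
      fix a assume "a < dim_vec (c \<cdot>\<^sub>v x)"
      then show "(X *\<^sub>v r) $ a = (c \<cdot>\<^sub>v x) $ a"
        using x r by (simp add: X_def c_def scalar_prod_def lessThan_atLeast0 sum_distrib_left
            sum_distrib_right ac_simps)
    qed (use x in \<open>simp add: X_def\<close>)
    then have "(1\<^sub>m m + X) *\<^sub>v r = r + c \<cdot>\<^sub>v x"
      using X r by (simp add: add_mult_distrib_mat_vec[of _ m m])
    also have "\<dots> = c \<cdot>\<^sub>v unit_vec m k"
      using r \<open>c \<noteq> 0\<close> by (intro eq_vecI) (auto simp: x_def field_simps)
    finally show "(1\<^sub>m m + X) *\<^sub>v r = c \<cdot>\<^sub>v unit_vec m k" .
  qed
qed

section \<open>Skew-symmetric matrices with a single nonzero entry in a row\<close>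

definition lower_block :: "'a mat \<Rightarrow> 'a mat" where
  "lower_block A = mat (dim_row A - 2) (dim_col A - 2) (\<lambda>(i, j). A $$ (Suc (Suc i), Suc (Suc j)))"

lemma lower_block_carrier:
  "A \<in> carrier_mat (Suc (Suc m)) (Suc (Suc m)) \<Longrightarrow> lower_block A \<in> carrier_mat m m"
  by (simp add: lower_block_def)

lemma lower_block_entry:
  "A \<in> carrier_mat (Suc (Suc m)) (Suc (Suc m)) \<Longrightarrow> i < m \<Longrightarrow> j < m \<Longrightarrow>
    lower_block A $$ (i, j) = A $$ (Suc (Suc i), Suc (Suc j))"
  by (simp add: lower_block_def)

lemma lower_block_skew_mats:
  assumes A: "A \<in> skew_mats (Suc (Suc m))"
  shows "lower_block A \<in> skew_mats m"
  unfolding skew_mats_iff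
proof (intro conjI allI impI)
  show "lower_block A \<in> carrier_mat m m" by (rule lower_block_carrier[OF skew_mats_carrier[OF A]])
  fix i j assume "i < m" "j < m"
  then show "lower_block A $$ (j, i) = - lower_block A $$ (i, j)"
    unfolding lower_block_entry[OF skew_mats_carrier[OF A] \<open>i < m\<close> \<open>j < m\<close>]
      lower_block_entry[OF skew_mats_carrier[OF A] \<open>j < m\<close> \<open>i < m\<close>]
    by (intro skew_mats_entry[OF A]) simp_all
qed

lemma pivot_row_entry:
  assumes "A \<in> carrier_mat m m" "row A i = c \<cdot>\<^sub>v unit_vec m k" "i < m" "j < m"
  shows "A $$ (i, j) = (if j = k then (c::'a::semiring_1) else 0)"
proof -
  have "A $$ (i, j) = row A i $ j" using assms(1,3,4) by simp
  then show ?thesis unfolding assms(2) using assms(4) by (simp add: unit_vec_def)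
qed

text \<open>
  Expand along row \<open>i\<close>, whose only nonzero entry stands in column \<open>k\<close>.  After deleting both, the
  first column of the remaining matrix comes from column \<open>i\<close> of \<open>A\<close>, and by skew symmetry its only
  nonzero entry is \<open>- c\<close>; the two signs cancel.
\<close>
lemma det_pivot_row:
  fixes A :: "'a::comm_ring_1 mat"
  assumes A: "A \<in> skew_mats (Suc (Suc m))"
    and ik: "i = 0 \<and> k = 1 \<or> i = 1 \<and> k = 0"
    and row: "row A i = c \<cdot>\<^sub>v unit_vec (Suc (Suc m)) k"
  shows "det A = c ^ 2 * det (lower_block A)"
proof -
  let ?N = "Suc (Suc m)"
  have AC: "A \<in> carrier_mat ?N ?N" by (rule skew_mats_carrier[OF A])
  have iN: "i < ?N" "k < ?N" "i + k = 1" using ik by auto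
  note entry = pivot_row_entry[OF AC row iN(1)]
  define B where "B = mat_delete A i k"
  have BC: "B \<in> carrier_mat (Suc m) (Suc m)"
    using mat_delete_carrier[OF AC, of i k] by (simp add: B_def)
  have B_col: "B $$ (a, 0) = (if a = 0 then - c else 0)" if "a < Suc m" for a
  proof -
    have "B $$ (a, 0) = A $$ (if a = 0 then k else Suc a, i)"
      using ik that AC by (auto simp: B_def mat_delete_def)
    also have "\<dots> = - A $$ (i, if a = 0 then k else Suc a)"
      using iN that by (intro skew_mats_entry[OF A]) auto
    finally show ?thesis using entry[of "if a = 0 then k else Suc a"] iN that ik by auto
  qed
  have del: "mat_delete B 0 0 = lower_block A"
    using ik AC BC by (intro eq_matI) (auto simp: B_def mat_delete_def lower_block_def)
  have "det B = (\<Sum>a<Suc m. B $$ (a, 0) * cofactor B a 0)"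
    using laplace_expansion_column[OF BC, of 0] by simp
  also have "\<dots> = (\<Sum>a<Suc m. if a = 0 then - c * cofactor B 0 0 else 0)"
    by (intro sum.cong) (auto simp: B_col)
  also have "\<dots> = - c * det (lower_block A)"
    by (simp add: cofactor_def del)
  finally have detB: "det B = - c * det (lower_block A)" .
  have "det A = (\<Sum>j<?N. A $$ (i, j) * cofactor A i j)"
    by (rule laplace_expansion_row[OF AC iN(1)])
  also have "\<dots> = (\<Sum>j<?N. if j = k then c * cofactor A i k else 0)"
    by (intro sum.cong) (auto simp: entry)
  also have "\<dots> = - c * det B"
    using iN by (simp add: cofactor_def B_def sum.delta' del: sum.lessThan_Suc)
  finally show ?thesis by (simp add: detB power2_eq_square)
qed

text \<open>
  Outside the lower blocks, the only products of entries that survive come from the positions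
  \<open>(0, 1)\<close> and \<open>(1, 0)\<close>, each contributing \<open>b c\<close>: row and column 0 of \<open>A\<close> and row and column 1 of \<open>T\<close>
  vanish elsewhere.
\<close>
lemma trace_pivot_rows:
  fixes A T :: "'a::field mat"
  assumes A: "A \<in> skew_mats (Suc (Suc m))" and T: "T \<in> skew_mats (Suc (Suc m))"
    and rowA: "row A 0 = b \<cdot>\<^sub>v unit_vec (Suc (Suc m)) 1"
    and rowT: "row T 1 = c \<cdot>\<^sub>v unit_vec (Suc (Suc m)) 0"
  shows "trace_mat (A * T) = 2 * b * c + trace_mat (lower_block A * lower_block T)"
proof -
  let ?N = "Suc (Suc m)"
  note AC = skew_mats_carrier[OF A] and TC = skew_mats_carrier[OF T]
  have a0: "A $$ (0, j) = (if j = 1 then b else 0)" if "j < ?N" for j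
    using pivot_row_entry[OF AC rowA _ that] by simp
  have t1: "T $$ (1, j) = (if j = 0 then c else 0)" if "j < ?N" for j
    using pivot_row_entry[OF TC rowT _ that] by simp
  have a0': "A $$ (j, 0) = (if j = 1 then - b else 0)" if "j < ?N" for j
    using skew_mats_entry[OF A _ that, of 0] a0[OF that] by simp
  have t1': "T $$ (j, 1) = (if j = 0 then - c else 0)" if "j < ?N" for j
    using skew_mats_entry[OF T _ that, of 1] t1[OF that] by simp
  let ?s = "\<lambda>i. \<Sum>j<?N. A $$ (i, j) * T $$ (j, i)"
  have "?s 0 = (\<Sum>j<?N. if j = 1 then b * c else 0)"
    by (intro sum.cong) (use t1[of 0] in \<open>auto simp: a0\<close>)
  then have s0: "?s 0 = b * c" by (simp add: sum.delta' del: sum.lessThan_Suc)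
  have "?s 1 = (\<Sum>j<?N. if j = 0 then b * c else 0)"
    by (intro sum.cong) (use a0'[of 1] in \<open>auto simp: t1' simp del: One_nat_def\<close>)
  then have s1: "?s 1 = b * c" by (simp add: sum.delta' del: sum.lessThan_Suc)
  have s2: "?s (Suc (Suc i)) = (\<Sum>j<m. A $$ (Suc (Suc i), Suc (Suc j)) * T $$ (Suc (Suc j), Suc (Suc i)))"
    if "i < m" for i
    using that a0'[of "Suc (Suc i)"] t1[of "Suc (Suc i)"] by (simp add: sum.lessThan_Suc_shift del: sum.lessThan_Suc)
  have "trace_mat (A * T) = (\<Sum>i<?N. ?s i)" by (rule trace_mat_mult[OF AC TC])
  also have "\<dots> = ?s 0 + (?s 1 + (\<Sum>i<m. ?s (Suc (Suc i))))"
    by (subst sum.lessThan_Suc_shift, subst sum.lessThan_Suc_shift) simp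
  also have "(\<Sum>i<m. ?s (Suc (Suc i))) = trace_mat (lower_block A * lower_block T)"
    unfolding trace_mat_mult[OF lower_block_carrier[OF AC] lower_block_carrier[OF TC]]
  proof (rule sum.cong[OF refl])
    fix i assume "i \<in> {..<m}"
    then have i: "i < m" by simp
    show "?s (Suc (Suc i)) = (\<Sum>j<m. lower_block A $$ (i, j) * lower_block T $$ (j, i))"
      unfolding s2[OF i]
      using i by (intro sum.cong) (simp_all add: lower_block_entry[OF AC] lower_block_entry[OF TC])
  qed
  finally show ?thesis by (simp only: s0 s1) (simp add: algebra_simps)
qed

lemma less_Suc_Suc_cases:
  assumes "i < Suc (Suc m)"
  obtains "i = 0" | "i = Suc 0" | i' where "i' < m" "i = Suc (Suc i')"
  using assms by (metis less_Suc_eq_0_disj)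

text \<open>
  Besides the lower block, such a matrix is free only in the entries of row 1 to the right of the
  diagonal; the rest is given by \<open>b\<close> and skew symmetry.
\<close>
lemma card_pivot_row:
  fixes b :: "'a::{field,finite}"
  assumes two: "(2::'a) \<noteq> 0"
  shows "card {A \<in> skew_mats (Suc (Suc m)). row A 0 = b \<cdot>\<^sub>v unit_vec (Suc (Suc m)) 1 \<and> P (lower_block A)}
    = card (UNIV :: 'a set) ^ m * card {B \<in> skew_mats m. P B}"
proof -
  let ?N = "Suc (Suc m)"
  let ?S = "{A \<in> skew_mats ?N. row A 0 = b \<cdot>\<^sub>v unit_vec ?N 1 \<and> P (lower_block A)}"
  let ?T = "carrier_vec m \<times> {B \<in> skew_mats m. P B}"
  define split where "split A = (vec m (\<lambda>j. A $$ (1, Suc (Suc j))), lower_block A)" for A :: "'a mat"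
  \<comment> \<open>\<open>glue\<close> rebuilds the matrix from the free part \<open>x\<close> of row 1 and the lower block \<open>B\<close>.\<close>
  define glue where "glue = (\<lambda>(x :: 'a vec, B :: 'a mat). mat ?N ?N (\<lambda>(i, j).
    if i = 0 then (if j = 1 then b else 0)
    else if i = 1 then (if j = 0 then - b else if j = 1 then 0 else x $ (j - 2))
    else if j = 0 then 0 else if j = 1 then - x $ (i - 2) else B $$ (i - 2, j - 2)))"
  have "bij_betw split ?S ?T"
  proof (rule bij_betw_byWitness[where f' = glue])
    show "\<forall>A\<in>?S. glue (split A) = A"
    proof
      fix A assume "A \<in> ?S"
      then have A: "A \<in> skew_mats ?N" and row: "row A 0 = b \<cdot>\<^sub>v unit_vec ?N 1" by auto
      note AC = skew_mats_carrier[OF A]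
      have a0: "A $$ (0, j) = (if j = 1 then b else 0)" if "j < ?N" for j
        using pivot_row_entry[OF AC row _ that] by simp
      have a0': "A $$ (j, 0) = (if j = 1 then - b else 0)" if "j < ?N" for j
        using skew_mats_entry[OF A _ that, of 0] a0[OF that] by simp
      have a1: "A $$ (1, 1) = 0" by (rule skew_mats_diag[OF two A]) simp
      have a1': "A $$ (j, 1) = - A $$ (1, j)" if "j < ?N" for j
        using skew_mats_entry[OF A _ that, of 1] by simp
      show "glue (split A) = A"
      proof (rule eq_matI)
        fix i j assume "i < dim_row A" "j < dim_col A"
        then have i: "i < ?N" and j: "j < ?N" using AC by auto
        show "glue (split A) $$ (i, j) = A $$ (i, j)"
          using a0[OF j] a0'[OF i] a1 a1'[OF i] lower_block_entry[OF AC, of "i - 2" "j - 2"]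
          by (cases rule: less_Suc_Suc_cases[OF i]; cases rule: less_Suc_Suc_cases[OF j])
            (simp_all add: glue_def split_def)
      qed (use AC in \<open>auto simp: glue_def split_def\<close>)
    qed
    show "\<forall>xB\<in>?T. split (glue xB) = xB"
    proof
      fix xB :: "'a vec \<times> 'a mat" assume "xB \<in> ?T"
      then obtain x B where xB: "xB = (x, B)" "x \<in> carrier_vec m" "B \<in> carrier_mat m m"
        using skew_mats_carrier by blast
      have "vec m (\<lambda>j. glue (x, B) $$ (1, Suc (Suc j))) = x"
        using xB by (intro eq_vecI) (simp_all add: glue_def)
      moreover have "lower_block (glue (x, B)) = B"
        using xB by (intro eq_matI) (simp_all add: glue_def lower_block_def)
      ultimately show "split (glue xB) = xB" by (simp add: split_def xB)
    qed
    show "split ` ?S \<subseteq> ?T" using lower_block_skew_mats by (auto simp: split_def)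
    show "glue ` ?T \<subseteq> ?S"
    proof (rule image_subsetI)
      fix xB :: "'a vec \<times> 'a mat" assume "xB \<in> ?T"
      then obtain x B where xB: "xB = (x, B)" "x \<in> carrier_vec m" "B \<in> skew_mats m" "P B"
        by blast
      have "glue xB \<in> skew_mats ?N"
        unfolding skew_mats_iff
      proof (intro conjI allI impI)
        show "glue xB \<in> carrier_mat ?N ?N" by (simp add: glue_def xB)
        fix i j assume i: "i < ?N" and j: "j < ?N"
        show "glue xB $$ (j, i) = - glue xB $$ (i, j)"
          using skew_mats_entry[OF xB(3), of "i - 2" "j - 2"]
          by (cases rule: less_Suc_Suc_cases[OF i]; cases rule: less_Suc_Suc_cases[OF j])
            (simp_all add: glue_def xB(1))
      qed
      moreover have "row (glue xB) 0 = b \<cdot>\<^sub>v unit_vec ?N 1"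
        by (intro eq_vecI) (simp_all add: glue_def xB(1))
      moreover have "lower_block (glue xB) = B"
        using skew_mats_carrier[OF xB(3)] by (intro eq_matI) (simp_all add: glue_def lower_block_def xB(1))
      ultimately show "glue xB \<in> ?S" using xB(4) by blast
    qed
  qed
  then show ?thesis
    by (simp add: bij_betw_same_card card_cartesian_product card_carrier_vec)
qed

section \<open>Congruences that shift the trace\<close>

lemma congruence_addrow_entry:
  fixes A :: "'a::comm_ring_1 mat"
  assumes A: "A \<in> carrier_mat m m" "A $$ (l, l) = 0" and jl: "j < m" "l < m" "j \<noteq> l"
    and ab: "a < m" "b < m"
  shows "(addrow_mat m s j l * A * transpose_mat (addrow_mat m s j l)) $$ (a, b)
    = A $$ (a, b) + (if a = j then s * A $$ (l, b) else 0) + (if b = j then s * A $$ (a, l) else 0)"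
proof -
  let ?G = "addrow_mat m s j l"
  have GA: "?G * A = addrow s j l A" using addrow_mat[OF A(1) jl(2)] by simp
  have "?G * A * transpose_mat ?G = transpose_mat (?G * transpose_mat (?G * A))"
    using A by (subst transpose_mult[of _ m m _ m]) (auto intro!: mult_carrier_mat)
  also have "\<dots> = transpose_mat (addrow s j l (transpose_mat (addrow s j l A)))"
    unfolding GA using A by (subst addrow_mat[of _ m m]) (simp_all add: jl)
  finally show ?thesis using A jl ab by (simp add: algebra_simps)
qed

text \<open>
  Adding \<open>s\<close> times row and column 0 of \<open>A\<close> to row and column \<open>j\<close> is a congruence of determinant 1.  It
  adds \<open>s r\<close> to row \<open>j\<close> and \<open>- s r\<close> to column \<open>j\<close> of \<open>A\<close>, and as \<open>T\<close> is skew-symmetric too, both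
  changes add \<open>s (r T)\<^sub>j\<close> to the trace.  So \<open>s = u / (2 (r T)\<^sub>j)\<close> produces the shift \<open>u\<close>.
\<close>
lemma exists_shift_of_trace:
  fixes T :: "'a::field mat"
  assumes two: "(2::'a) \<noteq> 0" and T: "T \<in> skew_mats m" and jm: "j < m" "j \<noteq> 0"
    and r: "(\<Sum>l<m. r $ l * T $$ (l, j)) \<noteq> 0"
  obtains P Q where "P \<in> carrier_mat m m" "Q \<in> carrier_mat m m" "P * Q = 1\<^sub>m m"
    "\<And>A. A \<in> skew_mats m \<Longrightarrow> row A 0 = r \<Longrightarrow>
      det (P * A * transpose_mat P) = det A \<and> row (P * A * transpose_mat P) 0 = r
      \<and> trace_mat (P * A * transpose_mat P * T) = trace_mat (A * T) + u"
proof -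
  let ?w = "\<Sum>l<m. r $ l * T $$ (l, j)"
  define s where "s = u / (2 * ?w)"
  define G where "G = addrow_mat m s j 0"
  have G: "G \<in> carrier_mat m m" by (simp add: G_def)
  show thesis
  proof (rule that)
    show "G * addrow_mat m (- s) j 0 = 1\<^sub>m m"
      using addrow_mat_inv[of j m 0 s] jm by (simp add: G_def)
    fix A assume A: "A \<in> skew_mats m" and row: "row A 0 = r"
    note AC = skew_mats_carrier[OF A] and TC = skew_mats_carrier[OF T]
    let ?A = "G * A * transpose_mat G"
    have m0: "0 < m" using jm by simp
    have A0: "A $$ (0, 0) = 0" by (rule skew_mats_diag[OF two A m0])
    have r_eq: "A $$ (0, l) = r $ l" if "l < m" for l
      using row AC that m0 by (metis carrier_matD index_row(1))
    have r_eq': "A $$ (l, 0) = - r $ l" if "l < m" for l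
      using skew_mats_entry[OF A m0 that] r_eq[OF that] by simp
    note entry = congruence_addrow_entry[where s = s, OF AC A0 jm(1) m0 jm(2), folded G_def]
    have "det G = 1" using det_addrow_mat[OF jm(2)] by (simp add: G_def)
    then have "det ?A = det A" using det_congruence[OF AC G] by simp
    moreover have "row ?A 0 = r"
    proof (rule eq_vecI)
      fix i assume "i < dim_vec r"
      then have i: "i < m" using row AC by auto
      have "row ?A 0 $ i = ?A $$ (0, i)" using AC G m0 i by simp
      then show "row ?A 0 $ i = r $ i" using entry[OF m0 i] jm A0 r_eq[OF i] by simp
    qed (use row AC G in auto)
    moreover have "trace_mat (?A * T) = trace_mat (A * T) + u"
    proof -
      have col: "T $$ (j, a) = - T $$ (a, j)" if "a < m" for a
        by (rule skew_mats_entry[OF T that jm(1)])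
      have "trace_mat (?A * T) = (\<Sum>a<m. \<Sum>b<m. ?A $$ (a, b) * T $$ (b, a))"
        using AC G by (intro trace_mat_mult[OF _ TC]) simp
      also have "\<dots> = (\<Sum>a<m. \<Sum>b<m. A $$ (a, b) * T $$ (b, a)
          + (if a = j then s * r $ b * T $$ (b, j) else 0)
          + (if b = j then s * r $ a * T $$ (a, j) else 0))"
      proof (intro sum.cong refl)
        fix a b assume "a \<in> {..<m}" "b \<in> {..<m}"
        then have a: "a < m" and b: "b < m" by auto
        have flip: "A $$ (a, 0) * T $$ (j, a) = r $ a * T $$ (a, j)"
          unfolding r_eq'[OF a] col[OF a] by simp
        show "?A $$ (a, b) * T $$ (b, a) = A $$ (a, b) * T $$ (b, a)
          + (if a = j then s * r $ b * T $$ (b, j) else 0)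
          + (if b = j then s * r $ a * T $$ (a, j) else 0)"
          unfolding entry[OF a b] using r_eq[OF b]
          by (auto simp: distrib_right mult.assoc flip)
      qed
      also have "\<dots> = trace_mat (A * T) + s * ?w + s * ?w"
      proof -
        have "(\<Sum>a<m. \<Sum>b<m. if a = j then s * r $ b * T $$ (b, j) else 0) = s * ?w"
          by (subst sum.swap) (simp add: jm sum_distrib_left mult.assoc)
        moreover have "(\<Sum>a<m. \<Sum>b<m. if b = j then s * r $ a * T $$ (a, j) else 0) = s * ?w"
          by (simp add: jm sum_distrib_left mult.assoc)
        ultimately show ?thesis
          unfolding trace_mat_mult[OF AC TC] by (simp only: sum.distrib)
      qed
      also have "\<dots> = trace_mat (A * T) + u"
        using two r by (simp add: s_def add.assoc flip: mult_2)
      finally show ?thesis .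
    qed
    ultimately show "det ?A = det A \<and> row ?A 0 = r \<and> trace_mat (?A * T) = trace_mat (A * T) + u"
      by blast
  qed (simp_all add: G)
qed

lemma card_Collect_bij:
  assumes "bij_betw f S T" "\<And>x. x \<in> S \<Longrightarrow> R x \<longleftrightarrow> R' (f x)"
  shows "card {x \<in> S. R x} = card {y \<in> T. R' y}"
proof (rule bij_betw_same_card[of f])
  have "f ` {x \<in> S. R x} = {y \<in> T. R' y}"
    using assms bij_betw_imp_surj_on[OF assms(1)] by auto
  then show "bij_betw f {x \<in> S. R x} {y \<in> T. R' y}"
    using bij_betw_subset[OF assms(1), of "{x \<in> S. R x}"] by auto
qed

section \<open>Squares\<close>

lemma nonzero_squares_mult:
  fixes d :: "'a::field"
  assumes "d \<in> nonzero_squares" "x \<noteq> 0"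
  shows "d * x ^ 2 \<in> nonzero_squares"
proof -
  obtain y where "d = y ^ 2" "y \<noteq> 0" using assms(1) by (auto simp: nonzero_squares_def)
  then have "d * x ^ 2 = (y * x) ^ 2" "y * x \<noteq> 0" using assms(2) by (auto simp: power_mult_distrib)
  then show ?thesis unfolding nonzero_squares_def by blast
qed

lemma card_square_roots:
  fixes d :: "'a::field"
  assumes "(2::'a) \<noteq> 0" "d \<in> nonzero_squares"
  shows "card {b. b ^ 2 = d} = 2"
proof -
  obtain x where x: "d = x ^ 2" "x \<noteq> 0" using assms(2) by (auto simp: nonzero_squares_def)
  have "x \<noteq> - x"
  proof
    assume "x = - x"
    then have "x + x = 0" using eq_neg_iff_add_eq_0 by blast
    then show False using x assms(1) by (simp flip: mult_2)
  qed
  moreover have "{b. b ^ 2 = d} = {x, - x}" using x by (auto simp: power2_eq_iff)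
  ultimately show ?thesis by simp
qed

section \<open>Reduction to a pivot row\<close>

lemma skew_mats_0: "skew_mats 0 = {0\<^sub>m 0 0}"
  by (auto simp: skew_mats_def)

lemma skew_pivot_row_nonzero:
  fixes A :: "'a::comm_ring_1 mat"
  assumes "A \<in> skew_mats (Suc (Suc m))" "det A \<noteq> 0" "i < 2"
  shows "row A i \<noteq> 0\<^sub>v (Suc (Suc m))"
proof
  assume "row A i = 0\<^sub>v (Suc (Suc m))"
  then have "row A i = 0 \<cdot>\<^sub>v unit_vec (Suc (Suc m)) (1 - i)"
    by (intro eq_vecI) simp_all
  moreover have "i = 0 \<and> 1 - i = 1 \<or> i = 1 \<and> 1 - i = 0" using assms(3) by auto
  ultimately have "det A = 0 ^ 2 * det (lower_block A)" using det_pivot_row assms(1) by blast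
  then show False using assms(2) by simp
qed

lemma det_of_inverse_pair:
  fixes P :: "'a::field mat"
  assumes "P \<in> carrier_mat m m" "Q \<in> carrier_mat m m" "P * Q = 1\<^sub>m m"
  shows "det P \<noteq> 0"
proof -
  have "det P * det Q = 1" using assms det_mult det_one by metis
  then show ?thesis by auto
qed

text \<open>
  Pivot rows are used in position 0 for the matrices that are counted and in position 1 for the
  fixed matrix \<open>T\<close>; this mismatch is what makes \<open>trace_pivot_rows\<close> work without clearing any
  further entries of \<open>T\<close>.
\<close>
lemma exists_pivot_congruence:
  fixes A :: "'a::field mat"
  assumes two: "(2::'a) \<noteq> 0" and A: "A \<in> skew_mats (Suc (Suc m))" "det A \<noteq> 0"
    and ik: "i = 0 \<and> k = 1 \<or> i = 1 \<and> k = 0"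
  obtains P Q c where "P \<in> carrier_mat (Suc (Suc m)) (Suc (Suc m))"
    "Q \<in> carrier_mat (Suc (Suc m)) (Suc (Suc m))" "P * Q = 1\<^sub>m (Suc (Suc m))"
    "row (P * A * transpose_mat P) i = c \<cdot>\<^sub>v unit_vec (Suc (Suc m)) k"
proof -
  let ?N = "Suc (Suc m)"
  note AC = skew_mats_carrier[OF A(1)]
  have iN: "i < ?N" "k < ?N" "i \<noteq> k" and i2: "i < 2" using ik by auto
  have "row A i \<in> carrier_vec ?N" using AC iN(1) by (rule row_carrier_vec[rotated])
  moreover have "row A i $ i = 0" using skew_mats_diag[OF two A(1) iN(1)] AC iN by simp
  ultimately obtain P Q c where "P \<in> carrier_mat ?N ?N" "Q \<in> carrier_mat ?N ?N" "P * Q = 1\<^sub>m ?N"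
    "row P i = unit_vec ?N i" "P *\<^sub>v row A i = c \<cdot>\<^sub>v unit_vec ?N k"
    using exists_transvection_to_unit_vec[OF _ _ skew_pivot_row_nonzero[OF A i2] iN] by metis
  then show thesis using that[of P Q c] row_congruence[OF AC] iN by metis
qed

text \<open>
  By a congruence, which changes the determinant by a square, a pivot row is produced;
  the lower block is then handled by induction.
\<close>
lemma det_skew_mats_square:
  fixes A :: "'a::field mat"
  assumes two: "(2::'a) \<noteq> 0"
  shows "A \<in> skew_mats (2 * n) \<Longrightarrow> \<exists>x. det A = x ^ 2"
proof (induction n arbitrary: A)
  case 0
  then have "det A = 1 ^ 2" by (simp add: skew_mats_def)
  then show ?case by blast
next
  case (Suc n)
  let ?N = "Suc (Suc (2 * n))"
  have A: "A \<in> skew_mats ?N" using Suc.prems by simp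
  show ?case
  proof (cases "det A = 0")
    case True
    then have "det A = 0 ^ 2" by simp
    then show ?thesis by blast
  next
    case False
    have ik: "(0::nat) = 0 \<and> (1::nat) = 1 \<or> (0::nat) = 1 \<and> (1::nat) = 0" by simp
    obtain P Q c where P: "P \<in> carrier_mat ?N ?N" "Q \<in> carrier_mat ?N ?N" "P * Q = 1\<^sub>m ?N"
      and row: "row (P * A * transpose_mat P) 0 = c \<cdot>\<^sub>v unit_vec ?N 1"
      using exists_pivot_congruence[OF two A False ik] by blast
    let ?B = "P * A * transpose_mat P"
    have B: "?B \<in> skew_mats ?N" by (rule congruence_skew_mats[OF A P(1)])
    obtain x where x: "det (lower_block ?B) = x ^ 2"
      using Suc.IH[OF lower_block_skew_mats[OF B]] by blast
    have "det A * det P ^ 2 = c ^ 2 * x ^ 2"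
      using det_pivot_row[OF B ik row] det_congruence[OF skew_mats_carrier[OF A] P(1)] x by simp
    then have "det A = (c * x / det P) ^ 2"
      using det_of_inverse_pair[OF P] by (simp add: power_divide power_mult_distrib eq_divide_eq)
    then show ?thesis by blast
  qed
qed

section \<open>The number of skew-symmetric matrices with a given determinant\<close>

text \<open>
  A congruence takes \<open>r\<close> to \<open>c e\<^sub>1\<close>.  The factor \<open>x\<close> collects the effect of \<open>det P\<close> and of the
  pivot \<open>c\<close> on the determinant; only the fact that \<open>x\<^sup>2\<close> is a nonzero square matters, since the
  number of matrices with determinant \<open>d\<close> will turn out to be the same for all nonzero squares \<open>d\<close>.
\<close>
lemma exists_card_row_fibre:
  fixes r :: "'a::{field,finite} vec"
  assumes two: "(2::'a) \<noteq> 0"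
    and r: "r \<in> carrier_vec (Suc (Suc m))" "r $ 0 = 0" "r \<noteq> 0\<^sub>v (Suc (Suc m))"
  obtains x where "x \<noteq> 0" "\<And>d. card {A \<in> skew_mats (Suc (Suc m)). row A 0 = r \<and> det A = d}
    = card (UNIV :: 'a set) ^ m * card {B \<in> skew_mats m. det B = d * x ^ 2}"
proof -
  let ?N = "Suc (Suc m)"
  obtain P Q c where P: "P \<in> carrier_mat ?N ?N" and Q: "Q \<in> carrier_mat ?N ?N"
    and PQ: "P * Q = 1\<^sub>m ?N" and row0: "row P 0 = unit_vec ?N 0"
    and c: "c \<noteq> 0" and Pr: "P *\<^sub>v r = c \<cdot>\<^sub>v unit_vec ?N 1"
    using exists_transvection_to_unit_vec[OF r, of 1] by auto
  have QP: "Q * P = 1\<^sub>m ?N" using mat_mult_left_right_inverse[OF P Q PQ] .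
  have Pinj: "P *\<^sub>v v = P *\<^sub>v r \<longleftrightarrow> v = r" if "v \<in> carrier_vec ?N" for v
  proof
    assume "P *\<^sub>v v = P *\<^sub>v r"
    then have "(Q * P) *\<^sub>v v = (Q * P) *\<^sub>v r"
      using P Q r(1) that by (simp add: assoc_mult_mat_vec[of _ ?N ?N _ ?N])
    then show "v = r" using QP r(1) that by simp
  qed simp
  have detP: "det P \<noteq> 0" by (rule det_of_inverse_pair[OF P Q PQ])
  show thesis
  proof (rule that)
    show "det P / c \<noteq> 0" using detP c by simp
    fix d
    have "card {A \<in> skew_mats ?N. row A 0 = r \<and> det A = d}
      = card {B \<in> skew_mats ?N. row B 0 = c \<cdot>\<^sub>v unit_vec ?N 1 \<and> det B = d * det P ^ 2}"
    proof (rule card_Collect_bij[OF bij_betw_congruence[OF P Q PQ]])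
      fix A :: "'a mat" assume A: "A \<in> skew_mats ?N"
      note AC = skew_mats_carrier[OF A]
      have "row A 0 \<in> carrier_vec ?N" by (rule row_carrier_vec[OF zero_less_Suc AC])
      then have "row (P * A * transpose_mat P) 0 = c \<cdot>\<^sub>v unit_vec ?N 1 \<longleftrightarrow> row A 0 = r"
        unfolding row_congruence[OF AC P zero_less_Suc row0] Pr[symmetric] by (rule Pinj)
      then show "row A 0 = r \<and> det A = d \<longleftrightarrow> row (P * A * transpose_mat P) 0 = c \<cdot>\<^sub>v unit_vec ?N 1
          \<and> det (P * A * transpose_mat P) = d * det P ^ 2"
        using det_congruence[OF AC P] detP by simp
    qed
    also have "{B \<in> skew_mats ?N. row B 0 = c \<cdot>\<^sub>v unit_vec ?N 1 \<and> det B = d * det P ^ 2}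
      = {B \<in> skew_mats ?N. row B 0 = c \<cdot>\<^sub>v unit_vec ?N 1 \<and> det (lower_block B) = d * (det P / c) ^ 2}"
    proof (intro Collect_cong conj_cong refl)
      fix B :: "'a mat" assume "B \<in> skew_mats ?N" "row B 0 = c \<cdot>\<^sub>v unit_vec ?N 1"
      then have "det B = c ^ 2 * det (lower_block B)" by (intro det_pivot_row) simp_all
      then show "det B = d * det P ^ 2 \<longleftrightarrow> det (lower_block B) = d * (det P / c) ^ 2"
        using c by (simp add: power_divide eq_divide_eq mult.commute)
    qed
    also have "card \<dots> = card (UNIV :: 'a set) ^ m * card {B \<in> skew_mats m. det B = d * (det P / c) ^ 2}"
      by (rule card_pivot_row[OF two])
    finally show "card {A \<in> skew_mats ?N. row A 0 = r \<and> det A = d}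
      = card (UNIV :: 'a set) ^ m * card {B \<in> skew_mats m. det B = d * (det P / c) ^ 2}" .
  qed
qed

lemma sum_one_over_fibre:
  "(\<Sum>b\<in>UNIV. if Q b then 1 else (0::nat)) = card {b :: 'a::finite. Q b}"
  by (simp add: sum.If_cases)

text \<open>
  This case starts the induction below at size 2, because at size 0 the determinant is always 1
  and so not evenly distributed over the nonzero squares.
\<close>
lemma card_skew_mats_2_det:
  fixes d :: "'a::{field,finite}"
  assumes two: "(2::'a) \<noteq> 0" and d: "d \<in> nonzero_squares"
  shows "card {A \<in> skew_mats (Suc (Suc 0)). det A = d} = 2"
proof -
  let ?S = "{A \<in> skew_mats (Suc (Suc 0)). det A = d}"
  have "card ?S = (\<Sum>b\<in>UNIV. card {A \<in> ?S. A $$ (0, 1) = b})"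
    by (rule card_eq_sum_card_fibres) (simp_all add: finite_skew_mats)
  also have "\<dots> = (\<Sum>b\<in>UNIV. if b ^ 2 = d then 1 else 0)"
  proof (rule sum.cong[OF refl])
    fix b :: 'a
    have "{A \<in> ?S. A $$ (0, 1) = b}
      = {A \<in> skew_mats (Suc (Suc 0)). row A 0 = b \<cdot>\<^sub>v unit_vec (Suc (Suc 0)) 1 \<and> b ^ 2 = d}"
    proof -
      have "det A = d \<and> A $$ (0, 1) = b \<longleftrightarrow> row A 0 = b \<cdot>\<^sub>v unit_vec (Suc (Suc 0)) 1 \<and> b ^ 2 = d"
        if A: "A \<in> skew_mats (Suc (Suc 0))" for A
      proof -
        note AC = skew_mats_carrier[OF A]
        have row: "row A 0 = b \<cdot>\<^sub>v unit_vec (Suc (Suc 0)) 1 \<longleftrightarrow> A $$ (0, 1) = b"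
        proof
          assume b: "A $$ (0, 1) = b"
          have diag: "A $$ (0, 0) = 0" using skew_mats_diag[OF two A] by simp
          show "row A 0 = b \<cdot>\<^sub>v unit_vec (Suc (Suc 0)) 1"
          proof (rule eq_vecI)
            fix i assume "i < dim_vec (b \<cdot>\<^sub>v unit_vec (Suc (Suc 0)) 1)"
            then consider "i = 0" | "i = 1" by fastforce
            then show "row A 0 $ i = (b \<cdot>\<^sub>v unit_vec (Suc (Suc 0)) 1) $ i"
              by cases (use AC b diag in simp_all)
          qed (use AC in simp)
        qed (use pivot_row_entry[OF AC, of 0 b 1 1] in simp)
        have "det A = b ^ 2" if "row A 0 = b \<cdot>\<^sub>v unit_vec (Suc (Suc 0)) 1"
          using det_pivot_row[OF A _ that] lower_block_carrier[OF AC] by simp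
        then show ?thesis unfolding row by (metis row)
      qed
      then show ?thesis by blast
    qed
    then have "card {A \<in> ?S. A $$ (0, 1) = b} = card {B \<in> skew_mats 0 :: 'a mat set. b ^ 2 = d}"
      using card_pivot_row[OF two, of 0 b "\<lambda>_. b ^ 2 = d"] by simp
    then show "card {A \<in> ?S. A $$ (0, 1) = b} = (if b ^ 2 = d then 1 else 0)"
      by (simp add: skew_mats_0)
  qed
  also have "\<dots> = card {b. b ^ 2 = d}" by (rule sum_one_over_fibre)
  finally show ?thesis using card_square_roots[OF two d] by simp
qed

text \<open>
  By \<open>exists_card_row_fibre\<close> and the induction hypothesis, all \<open>q\<^bsup>2n+1\<^esup> - 1\<close> nonzero rows \<open>r\<close> with
  \<open>r\<^sub>0 = 0\<close> of a matrix of size \<open>2n + 2\<close> occur equally often as row 0.  The factor \<open>q - 1\<close> is on the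
  left-hand side since there are \<open>(q - 1) / 2\<close> nonzero squares, over which the invertible matrices are
  spread evenly.
\<close>
lemma card_skew_mats_det:
  fixes d :: "'a::{field,finite}"
  assumes two: "(2::'a) \<noteq> 0"
  defines "q \<equiv> real (card (UNIV :: 'a set))"
  shows "d \<in> nonzero_squares \<Longrightarrow> (q - 1) * real (card {A \<in> skew_mats (2 * Suc n). det A = d})
    = 2 * (q ^ (Suc n * n) * (\<Prod>i=1..Suc n. (q ^ (2 * i - 1) - 1)))"
proof (induction n arbitrary: d)
  case 0
  then show ?case using card_skew_mats_2_det[OF two, of d] by (simp add: numeral_2_eq_2)
next
  case (Suc n)
  define m where "m = 2 * Suc n"
  let ?N = "Suc (Suc m)"
  let ?S = "{A \<in> skew_mats ?N. det A = d}"
  let ?R = "{r \<in> carrier_vec ?N :: 'a vec set. r $ 0 = 0 \<and> r \<noteq> 0\<^sub>v ?N}"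
  define K where "K = 2 * (q ^ (Suc n * n) * (\<Prod>i=1..Suc n. (q ^ (2 * i - 1) - 1)))"
  have d0: "d \<noteq> 0" using Suc.prems by (auto simp: nonzero_squares_def)
  have fibre: "(q - 1) * real (card {A \<in> ?S. row A 0 = r}) = q ^ m * K" if "r \<in> ?R" for r
  proof -
    have r: "r \<in> carrier_vec ?N" "r $ 0 = 0" "r \<noteq> 0\<^sub>v ?N" using that by auto
    obtain x where "x \<noteq> 0" and x: "\<And>d. card {A \<in> skew_mats ?N. row A 0 = r \<and> det A = d}
      = card (UNIV :: 'a set) ^ m * card {B \<in> skew_mats m. det B = d * x ^ 2}"
      using exists_card_row_fibre[OF two r] by blast
    have "(q - 1) * real (card {B \<in> skew_mats m. det B = d * x ^ 2}) = K"
      unfolding m_def K_def by (rule Suc.IH[OF nonzero_squares_mult[OF Suc.prems \<open>x \<noteq> 0\<close>]])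
    moreover have "{A \<in> ?S. row A 0 = r} = {A \<in> skew_mats ?N. row A 0 = r \<and> det A = d}" by blast
    ultimately show ?thesis using x[of d] by (simp add: q_def mult.left_commute)
  qed
  have "card ?S = (\<Sum>r\<in>?R. card {A \<in> ?S. row A 0 = r})"
  proof (rule card_eq_sum_card_fibres)
    show "finite ?S" by (simp add: finite_skew_mats)
    show "finite ?R" by simp
    fix A assume "A \<in> ?S"
    then have A: "A \<in> skew_mats ?N" "det A \<noteq> 0" using d0 by auto
    show "row A 0 \<in> ?R"
      using row_carrier_vec[OF zero_less_Suc skew_mats_carrier[OF A(1)]]
        skew_mats_carrier[OF A(1)] skew_mats_diag[OF two A(1), of 0]
        skew_pivot_row_nonzero[OF A, of 0] by simp
  qed
  then have "(q - 1) * real (card ?S) = (\<Sum>r\<in>?R. (q - 1) * real (card {A \<in> ?S. row A 0 = r}))"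
    by (simp add: sum_distrib_left)
  also have "\<dots> = (\<Sum>r\<in>?R. q ^ m * K)" by (rule sum.cong[OF refl fibre])
  also have "\<dots> = (q ^ Suc m - 1) * (q ^ m * K)"
    by (simp add: card_vec_head_zero q_def of_nat_diff del: power_Suc)
  also have "\<dots> = 2 * (q ^ (Suc (Suc n) * Suc n) * (\<Prod>i=1..Suc (Suc n). (q ^ (2 * i - 1) - 1)))"
  proof -
    have prod: "(\<Prod>i=1..Suc (Suc n). (q ^ (2 * i - 1) - 1))
      = (\<Prod>i=1..Suc n. (q ^ (2 * i - 1) - 1)) * (q ^ Suc m - 1)"
      by (subst prod.cl_ivl_Suc) (simp add: m_def)
    have "Suc (Suc n) * Suc n = Suc n * n + m" by (simp add: m_def)
    then have power: "q ^ (Suc (Suc n) * Suc n) = q ^ (Suc n * n) * q ^ m" by (simp only: power_add)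
    show ?thesis unfolding K_def prod power by (simp only: ac_simps)
  qed
  finally show ?case by (simp add: m_def)
qed

section \<open>Vectors with given coordinate sum and squared product\<close>

text \<open>
  The diagonal term of the formula, where the argument \<open>d\<close> will be the product of the
  prescribed determinant and \<open>det T\<close>.
\<close>
definition torus_count :: "nat \<Rightarrow> 'a::field \<Rightarrow> 'a \<Rightarrow> nat" where
  "torus_count n d t = card {y \<in> carrier_vec n. 2 * (\<Sum>i<n. y $ i) = t \<and> (\<Prod>i<n. y $ i) ^ 2 = d}"

text \<open>
  The first coordinate \<open>a\<close> is split off.  The predicate \<open>P\<close> is left open so that the sum can be
  prescribed, as in the torus count, or ignored.
\<close>
lemma card_vec_prod_Suc:
  fixes d :: "'a::{field,finite}"
  assumes "d \<noteq> 0"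
  shows "card {y \<in> carrier_vec (Suc n). P (\<Sum>i<Suc n. y $ i) \<and> (\<Prod>i<Suc n. y $ i) ^ 2 = d}
    = (\<Sum>a\<in>UNIV - {0}. card {y \<in> carrier_vec n. P (a + (\<Sum>i<n. y $ i)) \<and> (\<Prod>i<n. y $ i) ^ 2 = d / a ^ 2})"
    (is "card ?S = (\<Sum>a\<in>_. card (?T a))")
proof -
  have "card ?S = (\<Sum>a\<in>UNIV. card {y \<in> ?S. y $ 0 = a})"
    by (rule card_eq_sum_card_fibres) simp_all
  also have "\<dots> = (\<Sum>a\<in>UNIV. if a = 0 then 0 else card (?T a))"
  proof (rule sum.cong[OF refl])
    fix a :: 'a
    let ?P = "\<lambda>y. P (\<Sum>i<Suc n. y $ i) \<and> (\<Prod>i<Suc n. y $ i) ^ 2 = d"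
    have "{y \<in> ?S. y $ 0 = a} = {y \<in> carrier_vec (Suc n). y $ 0 = a \<and> ?P y}" by blast
    then have "card {y \<in> ?S. y $ 0 = a} = card {v \<in> carrier_vec n. ?P (vCons a v)}"
      by (simp only: card_carrier_vec_Suc_head)
    also have "{v \<in> carrier_vec n. ?P (vCons a v)}
      = {v \<in> carrier_vec n. P (a + (\<Sum>i<n. v $ i)) \<and> a ^ 2 * (\<Prod>i<n. v $ i) ^ 2 = d}"
      by (simp add: sum.lessThan_Suc_shift prod.lessThan_Suc_shift power_mult_distrib
          del: sum.lessThan_Suc prod.lessThan_Suc)
    also have "card \<dots> = (if a = 0 then 0 else card (?T a))"
      using assms by (simp add: eq_divide_eq mult.commute)
    finally show "card {y \<in> ?S. y $ 0 = a} = (if a = 0 then 0 else card (?T a))" .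
  qed
  also have "\<dots> = (\<Sum>a\<in>UNIV - {0}. card (?T a))"
    by (simp add: sum.If_cases Compl_eq_Diff_UNIV)
  finally show ?thesis .
qed

lemma torus_count_Suc:
  fixes d :: "'a::{field,finite}"
  assumes "d \<noteq> 0"
  shows "torus_count (Suc n) d t = (\<Sum>a\<in>UNIV - {0}. torus_count n (d / a ^ 2) (t - 2 * a))"
proof -
  have "2 * (a + s) = t \<longleftrightarrow> 2 * s = t - 2 * a" for a s :: 'a
    by (auto simp: algebra_simps)
  then show ?thesis
    unfolding torus_count_def card_vec_prod_Suc[OF assms, where P = "\<lambda>s. 2 * s = t"] by simp
qed

lemma card_vec_prod_square:
  fixes d :: "'a::{field,finite}"
  assumes two: "(2::'a) \<noteq> 0"
  defines "q \<equiv> real (card (UNIV :: 'a set))"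
  shows "d \<in> nonzero_squares \<Longrightarrow>
    real (card {y \<in> carrier_vec (Suc n). (\<Prod>i<Suc n. y $ i) ^ 2 = d}) = 2 * (q - 1) ^ n"
proof (induction n arbitrary: d)
  case 0
  have zero: "carrier_vec 0 = {0\<^sub>v 0 :: 'a vec}" by auto
  have d0: "d \<noteq> 0" using 0 by (auto simp: nonzero_squares_def)
  have "card {y \<in> carrier_vec (Suc 0). (\<Prod>i<Suc 0. y $ i) ^ 2 = d}
      = (\<Sum>a\<in>UNIV - {0}. if a ^ 2 = d then 1 else 0)"
    using card_vec_prod_Suc[OF d0, where n = 0 and P = "\<lambda>_. True"] d0
    by (simp add: zero Collect_conv_if eq_divide_eq if_distrib cong: if_cong)
  also have "\<dots> = (\<Sum>a\<in>UNIV. if a ^ 2 = d then 1 else 0)"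
    by (rule sum.mono_neutral_left) (use d0 in auto)
  also have "\<dots> = 2" using sum_one_over_fibre card_square_roots[OF two 0] by metis
  finally show ?case by simp
next
  case (Suc n)
  have d0: "d \<noteq> 0" using Suc.prems by (auto simp: nonzero_squares_def)
  have "real (card {y \<in> carrier_vec (Suc (Suc n)). (\<Prod>i<Suc (Suc n). y $ i) ^ 2 = d})
    = (\<Sum>a\<in>UNIV - {0}. real (card {y \<in> carrier_vec (Suc n). (\<Prod>i<Suc n. y $ i) ^ 2 = d / a ^ 2}))"
    using card_vec_prod_Suc[OF d0, where n = "Suc n" and P = "\<lambda>_. True"] by simp
  also have "\<dots> = (\<Sum>a\<in>UNIV - {0::'a}. 2 * (q - 1) ^ n)"
  proof (rule sum.cong[OF refl])
    fix a :: 'a assume "a \<in> UNIV - {0}"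
    then have "d / a ^ 2 \<in> nonzero_squares"
      using nonzero_squares_mult[OF Suc.prems, of "inverse a"] by (simp add: divide_inverse power_inverse)
    then show "real (card {y \<in> carrier_vec (Suc n). (\<Prod>i<Suc n. y $ i) ^ 2 = d / a ^ 2}) = 2 * (q - 1) ^ n"
      by (rule Suc.IH)
  qed
  also have "\<dots> = 2 * (q - 1) ^ Suc n"
    by (simp add: q_def card_Diff_singleton of_nat_diff Suc_leI)
  finally show ?case .
qed

lemma sum_torus_count:
  fixes d :: "'a::{field,finite}"
  shows "(\<Sum>t\<in>UNIV. torus_count n d t) = card {y \<in> carrier_vec n. (\<Prod>i<n. y $ i) ^ 2 = d}"
proof -
  let ?S = "{y \<in> carrier_vec n. (\<Prod>i<n. y $ i) ^ 2 = d}"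
  have "card ?S = (\<Sum>t\<in>UNIV. card {y \<in> ?S. 2 * (\<Sum>i<n. y $ i) = t})"
    by (rule card_eq_sum_card_fibres) simp_all
  then show ?thesis by (simp add: torus_count_def conj_ac)
qed

section \<open>How the count depends on the trace\<close>

text \<open>
  If \<open>(r T)\<^sub>j = 0\<close> for all \<open>j \<noteq> 0\<close>, then \<open>r T\<close> is a multiple of \<open>e\<^sub>0\<close>, and so is \<open>e\<^sub>1 T = c e\<^sub>0\<close>.  Hence
  \<open>r - b e\<^sub>1\<close> is in the kernel of \<open>T\<close> for some \<open>b\<close>, and the kernel is trivial.
\<close>
lemma exists_shift_column:
  fixes T :: "'a::field mat"
  assumes T: "T \<in> skew_mats (Suc (Suc m))" "det T \<noteq> 0"
    and row: "row T 1 = c \<cdot>\<^sub>v unit_vec (Suc (Suc m)) 0"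
    and r: "r \<in> carrier_vec (Suc (Suc m))" "\<And>b. r \<noteq> b \<cdot>\<^sub>v unit_vec (Suc (Suc m)) 1"
  shows "\<exists>j<Suc (Suc m). j \<noteq> 0 \<and> (\<Sum>l<Suc (Suc m). r $ l * T $$ (l, j)) \<noteq> 0"
proof (rule ccontr)
  let ?N = "Suc (Suc m)"
  let ?w = "\<lambda>j. \<Sum>l<?N. r $ l * T $$ (l, j)"
  note TC = skew_mats_carrier[OF T(1)]
  assume "\<not> ?thesis"
  then have w: "?w j = 0" if "j < ?N" "j \<noteq> 0" for j using that by blast
  have "det T = c ^ 2 * det (lower_block T)" using det_pivot_row[OF T(1) _ row] by simp
  then have c: "c \<noteq> 0" using T(2) by auto
  \<comment> \<open>This choice of \<open>b\<close> makes entry 0 of \<open>(r - b e\<^sub>1) T\<close> vanish.\<close>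
  define b where "b = ?w 0 / c"
  define v where "v = r - b \<cdot>\<^sub>v unit_vec ?N 1"
  have v: "v \<in> carrier_vec ?N" using r(1) by (simp add: v_def)
  have "T *\<^sub>v v = 0\<^sub>v ?N"
  proof (rule eq_vecI)
    fix j assume "j < dim_vec (0\<^sub>v ?N)"
    then have j: "j < ?N" by simp
    have flip: "T $$ (j, l) = - T $$ (l, j)" if "l < ?N" for l
      by (rule skew_mats_entry[OF T(1) that j])
    have "(T *\<^sub>v v) $ j = row T j \<bullet> r - b * (row T j \<bullet> unit_vec ?N 1)"
      using TC r(1) j by (simp add: v_def scalar_prod_minus_distrib[of _ ?N])
    also have "row T j \<bullet> unit_vec ?N 1 = T $$ (j, 1)"
      using TC j by (simp add: scalar_prod_right_unit)
    also have "T $$ (j, 1) = (if j = 0 then - c else 0)"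
      using flip[of 1] pivot_row_entry[OF TC row _ j] by simp
    also have "row T j \<bullet> r = (\<Sum>l<?N. T $$ (j, l) * r $ l)"
      using TC r(1) j by (simp add: scalar_prod_def lessThan_atLeast0)
    also have "\<dots> = - ?w j"
      unfolding sum_negf[symmetric] by (intro sum.cong refl) (simp only: lessThan_iff flip, simp)
    finally show "(T *\<^sub>v v) $ j = 0\<^sub>v ?N $ j"
      using w[OF j] c j by (cases "j = 0") (simp_all add: b_def del: sum.lessThan_Suc)
  qed (use TC in simp)
  then have "v = 0\<^sub>v ?N" using det_0_iff_vec_prod_zero_field[OF TC] T(2) v by blast
  have "r = b \<cdot>\<^sub>v unit_vec ?N 1"
  proof (rule eq_vecI)
    fix i assume "i < dim_vec (b \<cdot>\<^sub>v unit_vec ?N 1)"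
    then have "i < ?N" by simp
    then have "v $ i = r $ i - (b \<cdot>\<^sub>v unit_vec ?N 1) $ i" using r(1) by (simp add: v_def)
    then show "r $ i = (b \<cdot>\<^sub>v unit_vec ?N 1) $ i" using \<open>v = 0\<^sub>v ?N\<close> \<open>i < ?N\<close> by simp
  qed (use r(1) in simp)
  then show False using r(2) by blast
qed

text \<open>
  The shifts of the trace by \<open>t' - t\<close> and by \<open>t - t'\<close> are injective maps between the two sets.
\<close>
lemma card_row_fibre_trace_uniform:
  fixes T :: "'a::{field,finite} mat"
  assumes two: "(2::'a) \<noteq> 0" and T: "T \<in> skew_mats m" and j: "j < m" "j \<noteq> 0"
    and r: "(\<Sum>l<m. r $ l * T $$ (l, j)) \<noteq> 0"
  shows "card {A \<in> skew_mats m. row A 0 = r \<and> det A = d \<and> trace_mat (A * T) = t}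
    = card {A \<in> skew_mats m. row A 0 = r \<and> det A = d \<and> trace_mat (A * T) = t'}"
    (is "card (?S t) = card (?S t')")
proof -
  have le: "card (?S t) \<le> card (?S t')" for t t'
  proof -
    obtain P Q where P: "P \<in> carrier_mat m m" "Q \<in> carrier_mat m m" "P * Q = 1\<^sub>m m"
      and shift: "\<And>A. A \<in> skew_mats m \<Longrightarrow> row A 0 = r \<Longrightarrow>
        det (P * A * transpose_mat P) = det A \<and> row (P * A * transpose_mat P) 0 = r
        \<and> trace_mat (P * A * transpose_mat P * T) = trace_mat (A * T) + (t' - t)"
      using exists_shift_of_trace[OF two T j r] by blast
    have "inj_on (\<lambda>A. P * A * transpose_mat P) (?S t)"
      using bij_betw_imp_inj_on[OF bij_betw_congruence[OF P]] by (rule inj_on_subset) blast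
    moreover have "(\<lambda>A. P * A * transpose_mat P) ` ?S t \<subseteq> ?S t'"
    proof (rule image_subsetI)
      fix A assume "A \<in> ?S t"
      then have A: "A \<in> skew_mats m" "row A 0 = r" "det A = d" "trace_mat (A * T) = t" by auto
      show "P * A * transpose_mat P \<in> ?S t'"
        using congruence_skew_mats[OF A(1) P(1)] shift[OF A(1,2)] A(3,4) by simp
    qed
    moreover have "finite (?S t')" by (simp add: finite_skew_mats)
    ultimately show ?thesis by (rule card_inj_on_le)
  qed
  show ?thesis by (rule antisym[OF le le])
qed

lemma card_pivot_row_trace:
  fixes T :: "'a::{field,finite} mat"
  assumes two: "(2::'a) \<noteq> 0" and T: "T \<in> skew_mats (Suc (Suc m))"
    and row: "row T 1 = c \<cdot>\<^sub>v unit_vec (Suc (Suc m)) 0" and b: "b \<noteq> 0"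
  shows "card {A \<in> skew_mats (Suc (Suc m)).
      row A 0 = b \<cdot>\<^sub>v unit_vec (Suc (Suc m)) 1 \<and> det A = d \<and> trace_mat (A * T) = t}
    = card (UNIV :: 'a set) ^ m * card {B \<in> skew_mats m.
      det B = d / b ^ 2 \<and> trace_mat (B * lower_block T) = t - 2 * (b * c)}"
proof -
  let ?N = "Suc (Suc m)"
  have "{A \<in> skew_mats ?N. row A 0 = b \<cdot>\<^sub>v unit_vec ?N 1 \<and> det A = d \<and> trace_mat (A * T) = t}
    = {A \<in> skew_mats ?N. row A 0 = b \<cdot>\<^sub>v unit_vec ?N 1 \<and> (det (lower_block A) = d / b ^ 2
        \<and> trace_mat (lower_block A * lower_block T) = t - 2 * (b * c))}"
  proof (intro Collect_cong conj_cong refl)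
    fix A assume A: "A \<in> skew_mats ?N" "row A 0 = b \<cdot>\<^sub>v unit_vec ?N 1"
    have "det A = b ^ 2 * det (lower_block A)" using det_pivot_row[OF A(1) _ A(2)] by simp
    then show "det A = d \<longleftrightarrow> det (lower_block A) = d / b ^ 2"
      using b by (simp add: eq_divide_eq mult.commute)
    show "trace_mat (A * T) = t \<longleftrightarrow> trace_mat (lower_block A * lower_block T) = t - 2 * (b * c)"
      unfolding trace_pivot_rows[OF A(1) T A(2) row] by (auto simp: algebra_simps)
  qed
  then show ?thesis using card_pivot_row[OF two] by simp
qed

text \<open>
  The rows \<open>r\<close> outside the line of \<open>e\<^sub>1\<close> contribute the same for every \<open>t\<close>.  On the line, the row
  \<open>0\<close> contributes nothing, and the rows \<open>b e\<^sub>1\<close> reduce to the lower block; the induction hypothesis is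
  used there for all the determinants \<open>d / b\<^sup>2\<close>.
\<close>
lemma trace_count_step:
  fixes T :: "'a::{field,finite} mat"
  assumes two: "(2::'a) \<noteq> 0" and T: "T \<in> skew_mats (Suc (Suc m))" "det T \<noteq> 0"
    and row: "row T 1 = c \<cdot>\<^sub>v unit_vec (Suc (Suc m)) 0" and d: "d \<noteq> 0"
    and IH: "\<And>d. d \<noteq> 0 \<Longrightarrow> \<exists>K. \<forall>t.
      real (card {B \<in> skew_mats m. det B = d \<and> trace_mat (B * lower_block T) = t})
        = K + x * real (torus_count n (d * det (lower_block T)) t)"
  shows "\<exists>K. \<forall>t. real (card {A \<in> skew_mats (Suc (Suc m)). det A = d \<and> trace_mat (A * T) = t})
    = K + real (card (UNIV :: 'a set)) ^ m * x * real (torus_count (Suc n) (d * det T) t)"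
proof -
  let ?N = "Suc (Suc m)"
  define q where "q = real (card (UNIV :: 'a set))"
  define S where "S t = {A \<in> skew_mats ?N. det A = d \<and> trace_mat (A * T) = t}" for t
  define pivot where "pivot = (\<lambda>b :: 'a. b \<cdot>\<^sub>v unit_vec ?N 1)"
  define fibre where "fibre t r = real (card {A \<in> skew_mats ?N.
    row A 0 = r \<and> det A = d \<and> trace_mat (A * T) = t})" for t r
  have detT: "det T = c ^ 2 * det (lower_block T)" using det_pivot_row[OF T(1) _ row] by simp
  then have c: "c \<noteq> 0" using T(2) by auto
  \<comment> \<open>The constant of the induction hypothesis depends on the determinant, hence on \<open>b\<close>.\<close>
  obtain K where K: "\<And>b t. b \<noteq> 0 \<Longrightarrow>
      real (card {B \<in> skew_mats m. det B = d / b ^ 2 \<and> trace_mat (B * lower_block T) = t})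
        = K b + x * real (torus_count n (d / b ^ 2 * det (lower_block T)) t)"
  proof -
    have "\<exists>K. b \<noteq> 0 \<longrightarrow> (\<forall>t.
        real (card {B \<in> skew_mats m. det B = d / b ^ 2 \<and> trace_mat (B * lower_block T) = t})
          = K + x * real (torus_count n (d / b ^ 2 * det (lower_block T)) t))" for b
      using IH[of "d / b ^ 2"] d by (cases "b = 0") auto
    from choice[OF allI[OF this]] show thesis
    proof (rule exE)
      fix K assume K: "\<forall>b. b \<noteq> 0 \<longrightarrow> (\<forall>t.
        real (card {B \<in> skew_mats m. det B = d / b ^ 2 \<and> trace_mat (B * lower_block T) = t})
          = K b + x * real (torus_count n (d / b ^ 2 * det (lower_block T)) t))"
      show thesis by (rule that[of K]) (rule spec[OF mp[OF spec[OF K]]])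
    qed
  qed
  have inj: "inj pivot"
  proof (rule injI)
    fix b b' assume "pivot b = pivot b'"
    then have "pivot b $ 1 = pivot b' $ 1" by simp
    then show "b = b'" by (simp add: pivot_def)
  qed
  have uniform: "fibre t r = fibre 0 r" if r: "r \<in> carrier_vec ?N - range pivot" for t r
  proof -
    have "\<exists>j<?N. j \<noteq> 0 \<and> (\<Sum>l<?N. r $ l * T $$ (l, j)) \<noteq> 0"
    proof (rule exists_shift_column[OF T row])
      show "r \<in> carrier_vec ?N" using r by blast
      show "r \<noteq> b \<cdot>\<^sub>v unit_vec ?N 1" for b using r unfolding pivot_def by blast
    qed
    then obtain j where j: "j < ?N" "j \<noteq> 0" "(\<Sum>l<?N. r $ l * T $$ (l, j)) \<noteq> 0"
      by (elim exE conjE) (rule that)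
    show ?thesis
      unfolding fibre_def by (rule arg_cong[OF card_row_fibre_trace_uniform[OF two T(1) j]])
  qed
  have pivot_fibre: "fibre t (pivot b)
      = q ^ m * (K b + x * real (torus_count n (d * det T / (b * c) ^ 2) (t - 2 * (b * c))))"
    if "b \<noteq> 0" for t b
  proof -
    have "d / b ^ 2 * det (lower_block T) = d * det T / (b * c) ^ 2"
      unfolding detT using c by (simp add: power_mult_distrib)
    then show ?thesis
      unfolding fibre_def pivot_def q_def card_pivot_row_trace[OF two T(1) row that]
      using K[OF that] by simp
  qed
  have pivot_fibre_0: "fibre t (pivot 0) = 0" for t
  proof -
    have "det A \<noteq> d" if "A \<in> skew_mats ?N" "row A 0 = pivot 0" for A
      using det_pivot_row[OF that(1), of 0 1 0] that(2) d by (simp add: pivot_def)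
    then have empty: "{A \<in> skew_mats ?N. row A 0 = pivot 0 \<and> det A = d \<and> trace_mat (A * T) = t} = {}"
      by blast
    show ?thesis unfolding fibre_def empty by simp
  qed
  have "real (card (S t)) = (\<Sum>r\<in>carrier_vec ?N - range pivot. fibre 0 r)
      + q ^ m * (\<Sum>b\<in>UNIV - {0}. K b) + q ^ m * x * real (torus_count (Suc n) (d * det T) t)" for t
  proof -
    have "card (S t) = (\<Sum>r\<in>carrier_vec ?N. card {A \<in> S t. row A 0 = r})"
    proof (rule card_eq_sum_card_fibres)
      fix A assume "A \<in> S t"
      then show "row A 0 \<in> carrier_vec ?N"
        unfolding S_def using row_carrier_vec[OF zero_less_Suc skew_mats_carrier] by blast
    qed (simp_all add: S_def finite_skew_mats)
    moreover have "{A \<in> S t. row A 0 = r}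
        = {A \<in> skew_mats ?N. row A 0 = r \<and> det A = d \<and> trace_mat (A * T) = t}" for r
      unfolding S_def by blast
    ultimately have "real (card (S t)) = (\<Sum>r\<in>carrier_vec ?N. fibre t r)"
      by (simp add: fibre_def)
    also have "\<dots> = (\<Sum>r\<in>carrier_vec ?N - range pivot. fibre t r) + (\<Sum>r\<in>range pivot. fibre t r)"
      by (rule sum.subset_diff) (auto simp: pivot_def)
    also have "(\<Sum>r\<in>carrier_vec ?N - range pivot. fibre t r) = (\<Sum>r\<in>carrier_vec ?N - range pivot. fibre 0 r)"
      by (rule sum.cong[OF refl uniform])
    also have "(\<Sum>r\<in>range pivot. fibre t r) = (\<Sum>b\<in>UNIV. fibre t (pivot b))"
      using sum.reindex[OF inj, of "fibre t"] by simp
    also have "\<dots> = (\<Sum>b\<in>UNIV - {0}. fibre t (pivot b))"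
      by (rule sum.mono_neutral_right) (auto simp: pivot_fibre_0)
    also have "\<dots> = (\<Sum>b\<in>UNIV - {0}.
        q ^ m * (K b + x * real (torus_count n (d * det T / (b * c) ^ 2) (t - 2 * (b * c)))))"
      by (rule sum.cong[OF refl]) (simp add: pivot_fibre)
    also have "\<dots> = q ^ m * (\<Sum>b\<in>UNIV - {0}. K b)
        + q ^ m * x * (\<Sum>b\<in>UNIV - {0}. real (torus_count n (d * det T / (b * c) ^ 2) (t - 2 * (b * c))))"
      by (simp add: sum.distrib sum_distrib_left algebra_simps)
    \<comment> \<open>The substitution \<open>a = b c\<close> turns the sum into the recursion for \<open>torus_count\<close>.\<close>
    also have "(\<Sum>b\<in>UNIV - {0}. real (torus_count n (d * det T / (b * c) ^ 2) (t - 2 * (b * c))))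
        = (\<Sum>a\<in>UNIV - {0}. real (torus_count n (d * det T / a ^ 2) (t - 2 * a)))"
      by (rule sum.reindex_bij_witness[of _ "\<lambda>a. a / c" "\<lambda>b. b * c"]) (use c in auto)
    also have "\<dots> = real (torus_count (Suc n) (d * det T) t)"
      using torus_count_Suc[of "d * det T" n t] d T(2) by simp
    finally show ?thesis by simp
  qed
  then show ?thesis unfolding S_def q_def by blast
qed

text \<open>
  The bijection is \<open>A \<mapsto> Q\<^sup>T A Q\<close>: as \<open>Q P = 1\<close>, the trace of
  \<open>Q\<^sup>T A Q P T P\<^sup>T\<close> is that of \<open>A T\<close>.
\<close>
lemma trace_count_congruence:
  fixes T :: "'a::{field,finite} mat"
  assumes T: "T \<in> carrier_mat m m" and P: "P \<in> carrier_mat m m" "Q \<in> carrier_mat m m" "P * Q = 1\<^sub>m m"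
  shows "card {A \<in> skew_mats m. det A = d \<and> trace_mat (A * T) = t}
    = card {A \<in> skew_mats m. det A = d * det Q ^ 2 \<and> trace_mat (A * (P * T * transpose_mat P)) = t}"
proof (rule card_Collect_bij)
  have QP: "Q * P = 1\<^sub>m m" by (rule mat_mult_left_right_inverse[OF P])
  have tr: "transpose_mat Q * transpose_mat P = 1\<^sub>m m" "transpose_mat P * transpose_mat Q = 1\<^sub>m m"
    using P QP by (metis transpose_mult transpose_one)+
  show "bij_betw (\<lambda>A. transpose_mat Q * A * transpose_mat (transpose_mat Q)) (skew_mats m) (skew_mats m)"
    by (rule bij_betw_congruence[OF _ _ tr(1)]) (use P in simp_all)
  fix A :: "'a mat" assume "A \<in> skew_mats m"
  then have A: "A \<in> carrier_mat m m" by (rule skew_mats_carrier)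
  let ?B = "transpose_mat Q * A * transpose_mat (transpose_mat Q)"
  have "det Q \<noteq> 0" by (rule det_of_inverse_pair[OF P(2,1) QP])
  then have "det ?B = d * det Q ^ 2 \<longleftrightarrow> det A = d"
    using det_congruence[OF A, of "transpose_mat Q"] P(2) by (simp add: det_transpose)
  moreover have "trace_mat (?B * (P * T * transpose_mat P)) = trace_mat (A * T)"
  proof -
    have "?B * (P * T * transpose_mat P) = transpose_mat Q * (A * (Q * P) * T * transpose_mat P)"
      using A P T by (simp add: assoc_mult_mat[of _ m m _ m _ m])
    then have "trace_mat (?B * (P * T * transpose_mat P))
        = trace_mat (transpose_mat Q * (A * (Q * P) * T * transpose_mat P))"
      by (rule arg_cong)
    also have "\<dots> = trace_mat ((A * (Q * P) * T * transpose_mat P) * transpose_mat Q)"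
      by (rule trace_mat_mult_commute[of _ m m]) (use A P T in \<open>auto intro!: mult_carrier_mat\<close>)
    also have "(A * (Q * P) * T * transpose_mat P) * transpose_mat Q
        = A * (Q * P) * T * (transpose_mat P * transpose_mat Q)"
      using A P T by (simp add: assoc_mult_mat[of _ m m _ m _ m])
    finally show ?thesis using A T by (simp add: tr QP)
  qed
  ultimately show "det A = d \<and> trace_mat (A * T) = t \<longleftrightarrow>
      det ?B = d * det Q ^ 2 \<and> trace_mat (?B * (P * T * transpose_mat P)) = t"
    by simp
qed

text \<open>
  The congruence that gives \<open>T\<close> a pivot row leaves \<open>d det T\<close> unchanged, which is why the torus count
  can depend on \<open>d\<close> and \<open>T\<close> through this product only.
\<close>
lemma trace_count_eq_const_plus_torus_count:
  fixes T :: "'a::{field,finite} mat"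
  assumes two: "(2::'a) \<noteq> 0"
  shows "T \<in> skew_mats (2 * n) \<Longrightarrow> det T \<noteq> 0 \<Longrightarrow> d \<noteq> 0 \<Longrightarrow>
    \<exists>K. \<forall>t. real (card {A \<in> skew_mats (2 * n). det A = d \<and> trace_mat (A * T) = t})
      = K + real (card (UNIV :: 'a set)) ^ (n * (n - 1)) * real (torus_count n (d * det T) t)"
proof (induction n arbitrary: T d)
  case 0
  have zero: "carrier_vec 0 = {0\<^sub>v 0 :: 'a vec}" by auto
  have T: "T = 0\<^sub>m 0 0" using 0 by (simp add: skew_mats_0)
  have "card {A \<in> skew_mats 0. det A = d \<and> trace_mat (A * T) = t} = torus_count 0 (d * det T) t" for t
  proof -
    have "{A \<in> skew_mats 0. det A = d \<and> trace_mat (A * T) = t}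
        = (if 1 = d \<and> 0 = t then {0\<^sub>m 0 0} else {})"
      by (auto simp: skew_mats_0 T trace_mat_def)
    moreover have "{y \<in> carrier_vec 0 :: 'a vec set. 2 * (\<Sum>i<0. y $ i) = t \<and> (\<Prod>i<0. y $ i) ^ 2 = d}
        = (if 1 = d \<and> 0 = t then {0\<^sub>v 0} else {})"
      unfolding zero by auto
    ultimately show ?thesis unfolding torus_count_def by (simp add: T)
  qed
  then show ?case by (intro exI[of _ 0]) simp
next
  case (Suc n)
  let ?N = "Suc (Suc (2 * n))"
  have T: "T \<in> skew_mats ?N" using Suc.prems(1) by simp
  obtain P Q c where P: "P \<in> carrier_mat ?N ?N" "Q \<in> carrier_mat ?N ?N" "P * Q = 1\<^sub>m ?N"
    and row: "row (P * T * transpose_mat P) 1 = c \<cdot>\<^sub>v unit_vec ?N 0"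
    using exists_pivot_congruence[OF two T Suc.prems(2), of 1 0] by blast
  let ?T = "P * T * transpose_mat P"
  let ?d = "d * det Q ^ 2"
  have T': "?T \<in> skew_mats ?N" by (rule congruence_skew_mats[OF T P(1)])
  have PQ: "det P * det Q = 1" using P det_mult det_one by metis
  then have det0: "det P \<noteq> 0" "det Q \<noteq> 0" by auto
  have detT: "det ?T = det T * det P ^ 2" by (rule det_congruence[OF skew_mats_carrier[OF T] P(1)])
  have detT0: "det ?T \<noteq> 0" using detT det0 Suc.prems(2) by simp
  have lower0: "det (lower_block ?T) \<noteq> 0" using det_pivot_row[OF T' _ row] detT0 by auto
  have size: "2 * Suc n = ?N" by simp
  have dets: "?d * det ?T = d * det T"
  proof -
    have "?d * det ?T = d * det T * (det P * det Q) ^ 2"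
      unfolding detT by (simp add: power_mult_distrib)
    then show ?thesis by (simp add: PQ)
  qed
  have "2 * n + n * (n - 1) = Suc n * (Suc n - 1)" by (cases n) simp_all
  then have powers: "real (card (UNIV :: 'a set)) ^ (2 * n) * real (card (UNIV :: 'a set)) ^ (n * (n - 1))
      = real (card (UNIV :: 'a set)) ^ (Suc n * (Suc n - 1))"
    by (simp only: flip: power_add)
  have "\<exists>K. \<forall>t. real (card {A \<in> skew_mats ?N. det A = ?d \<and> trace_mat (A * ?T) = t})
    = K + real (card (UNIV :: 'a set)) ^ (2 * n) * real (card (UNIV :: 'a set)) ^ (n * (n - 1))
      * real (torus_count (Suc n) (?d * det ?T) t)"
    by (rule trace_count_step[OF two T' detT0 row _ Suc.IH[OF lower_block_skew_mats[OF T'] lower0]])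
      (use det0 Suc.prems(3) in simp_all)
  then show ?case
    unfolding size trace_count_congruence[OF skew_mats_carrier[OF T] P] dets powers .
qed

section \<open>The count\<close>

text \<open>
  The constant left open so far is found by summing over \<open>t\<close>.  The case \<open>n = 0\<close> is apart because the
  determinants of invertible skew-symmetric matrices, and the squared products of nonzero coordinates, are evenly
  distributed over the nonzero squares only for \<open>n > 0\<close>.
\<close>
lemma trace_count_formula:
  fixes T :: "'a::{field,finite} mat" and d t :: 'a
  assumes two: "(2::'a) \<noteq> 0" and T: "T \<in> skew_mats (2 * n)" "det T \<noteq> 0" and d: "d \<in> nonzero_squares"
  defines "q \<equiv> real (card (UNIV :: 'a set))"
  shows "real (card {A \<in> skew_mats (2 * n). det A = d \<and> trace_mat (A * T) = t}) =
    2 / (q * (q - 1)) * (q ^ (n * (n - 1)) * (\<Prod>i=1..n. (q ^ (2 * i - 1) - 1))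
        - q ^ (n * (n - 1)) * (q - 1) ^ n)
    + q ^ (n * (n - 1)) * real (torus_count n (d * det T) t)"
proof -
  define Q where "Q = q ^ (n * (n - 1))"
  let ?M = "{A \<in> skew_mats (2 * n). det A = d}"
  have d0: "d \<noteq> 0" using d by (auto simp: nonzero_squares_def)
  obtain K where K: "\<And>t. real (card {A \<in> skew_mats (2 * n). det A = d \<and> trace_mat (A * T) = t})
      = K + Q * real (torus_count n (d * det T) t)"
    using trace_count_eq_const_plus_torus_count[OF two T d0] unfolding q_def Q_def by blast
  have "card {0, 1 :: 'a} \<le> card (UNIV :: 'a set)" by (rule card_mono) simp_all
  then have q: "q \<ge> 2" by (simp add: q_def)
  have "card ?M = (\<Sum>t\<in>UNIV. card {A \<in> ?M. trace_mat (A * T) = t})"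
    by (rule card_eq_sum_card_fibres) (simp_all add: finite_skew_mats)
  then have "real (card ?M) = (\<Sum>t\<in>UNIV. K + Q * real (torus_count n (d * det T) t))"
    using K by (simp add: conj_ac)
  also have "\<dots> = q * K + Q * real (\<Sum>t\<in>UNIV. torus_count n (d * det T) t)"
    by (simp add: sum.distrib sum_distrib_left q_def)
  finally have total: "real (card ?M)
      = q * K + Q * real (card {y \<in> carrier_vec n. (\<Prod>i<n. y $ i) ^ 2 = d * det T})"
    by (simp only: sum_torus_count)
  have "K = 2 / (q * (q - 1)) * (Q * (\<Prod>i=1..n. (q ^ (2 * i - 1) - 1)) - Q * (q - 1) ^ n)"
  proof (cases n)
    case 0
    have zero: "carrier_vec 0 = {0\<^sub>v 0 :: 'a vec}" by auto
    have "T = 0\<^sub>m 0 0" using T 0 by (simp add: skew_mats_0)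
    moreover have "card {A \<in> skew_mats 0. det A = d} = (if 1 = d then 1 else 0)"
      by (simp add: skew_mats_0 Collect_conv_if)
    moreover have "card {y \<in> carrier_vec 0 :: 'a vec set. (\<Prod>i<0. y $ i) ^ 2 = d} = (if 1 = d then 1 else 0)"
      by (simp add: zero Collect_conv_if)
    ultimately have "q * K = 0" using total 0 by (simp add: Q_def split: if_splits)
    then show ?thesis using q 0 by simp
  next
    case (Suc k)
    obtain x where x: "det T = x ^ 2" using det_skew_mats_square[OF two T(1)] by blast
    have "d * det T \<in> nonzero_squares"
      unfolding x by (rule nonzero_squares_mult[OF d]) (use x T(2) in auto)
    then have torus: "real (card {y \<in> carrier_vec n. (\<Prod>i<n. y $ i) ^ 2 = d * det T}) = 2 * (q - 1) ^ k"
      using card_vec_prod_square[OF two] unfolding q_def Suc by blast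
    have "(q - 1) * real (card ?M) = 2 * (Q * (\<Prod>i=1..n. (q ^ (2 * i - 1) - 1)))"
      using card_skew_mats_det[OF two d, of k] unfolding q_def Q_def Suc by simp
    then have "(q - 1) * (q * K) = 2 * (Q * (\<Prod>i=1..n. (q ^ (2 * i - 1) - 1)) - Q * (q - 1) ^ n)"
      unfolding total torus by (simp add: Suc algebra_simps)
    then show ?thesis using q by (simp add: field_simps)
  qed
  then show ?thesis using K[of t] by (simp add: Q_def)
qed

theorem corollary3p4p6:
  fixes q n :: nat and T :: "'a::{field,finite} mat" and d t :: 'a
  assumes "primepow q" and "odd q" and "card (UNIV :: 'a set) = q"
    and "T \<in> Alt_units (2 * n)"
    and "d \<in> nonzero_squares"
  shows "real (card {A \<in> Alt_units (2 * n). det A = d \<and> trace_mat (A * T) = t}) =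
    2 / (real q * (real q - 1)) *
      (real q ^ (n * (n - 1)) * (\<Prod>i=1..n. (real q ^ (2 * i - 1) - 1))
        - real q ^ (n * (n - 1)) * (real q - 1) ^ n)
    + real q ^ (n * (n - 1)) *
      real (card {y \<in> carrier_vec n.
        2 * (\<Sum>i<n. y $ i) = t \<and> (\<Prod>i<n. y $ i) ^ 2 / det T = d})"
proof -
  have two: "(2::'a) \<noteq> 0" using two_nonzero_if_odd_card assms(2,3) by blast
  have T: "T \<in> skew_mats (2 * n)" "det T \<noteq> 0" using assms(4) by (simp_all add: Alt_units_iff)
  have "d \<noteq> 0" using assms(5) by (auto simp: nonzero_squares_def)
  then have lhs: "{A \<in> Alt_units (2 * n). det A = d \<and> trace_mat (A * T) = t}
      = {A \<in> skew_mats (2 * n). det A = d \<and> trace_mat (A * T) = t}"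
    by (auto simp: Alt_units_iff)
  have "{y \<in> carrier_vec n. 2 * (\<Sum>i<n. y $ i) = t \<and> (\<Prod>i<n. y $ i) ^ 2 / det T = d}
      = {y \<in> carrier_vec n. 2 * (\<Sum>i<n. y $ i) = t \<and> (\<Prod>i<n. y $ i) ^ 2 = d * det T}"
    using T(2) by (simp add: divide_eq_eq)
  then show ?thesis
    unfolding lhs using trace_count_formula[OF two T assms(5), of t]
    unfolding torus_count_def assms(3) by simp
qed

end
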